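(* Let $A\in M_{m,n}$ and $k\ge1$. Let $G=\mathcal{G}_{lr}$ and let $e=(I_m,I_n,\mathrm{id}_R)\in G^{(k)}$ be the identity of the group $G^{(k)}$. Then the tangent image, i.e. the image $\widetilde T_{\mathrm{jet}_k(A)}\left(G^{(k)}\mathrm{jet}_k(A)\right)$ of the tangent map $$T_eG^{(k)}\to T_{\mathrm{jet}_k(A)}\left(G^{(k)}\mathrm{jet}_k(A)\right)$$ of the orbit map, considered as a subspace of $M^{(k)}_{m,n}$, is the submodule $$\left(\langle E_{m,pq}\cdot A\rangle+\langle A\cdot E_{n,hl}\rangle+\mathfrak{m}\cdot\left\langle\frac{\partial A}{\partial x_\nu}\right\rangle+\mathfrak{m}^{k+1}\cdot M_{m,n}\right)\Big/\mathfrak{m}^{k+1}\cdot M_{m,n}.$$ Moreover, the tangent images for $\mathcal{R}$, $\mathcal{G}_l$ and $\mathcal{G}_r$ are respectively $$\widetilde T_{\mathrm{jet}_k(A)}\left(\mathcal{R}^{(k)}\mathrm{jet}_k(A)\right)=\left(\mathfrak{m}\cdot\left\langle\frac{\partial A}{\partial x_\nu}\right\rangle+\mathfrak{m}^{k+1}\cdot M_{m,n}\right)\Big/\mathfrak{m}^{k+1}\cdot M_{m,n},$$ $$\widetilde T_{\mathrm{jet}_k(A)}\left(\mathcal{G}_l^{(k)}\mathrm{jet}_k(A)\right)=\left(\langle E_{m,pq}\cdot A\rangle+\mathfrak{m}\cdot\left\langle\frac{\partial A}{\partial x_\nu}\right\rangle+\mathfrak{m}^{k+1}\cdot M_{m,n}\right)\Big/\mathfrak{m}^{k+1}\cdot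 M_{m,n},$$ $$\widetilde T_{\mathrm{jet}_k(A)}\left(\mathcal{G}_r^{(k)}\mathrm{jet}_k(A)\right)=\left(\langle A\cdot E_{n,hl}\rangle+\mathfrak{m}\cdot\left\langle\frac{\partial A}{\partial x_\nu}\right\rangle+\mathfrak{m}^{k+1}\cdot M_{m,n}\right)\Big/\mathfrak{m}^{k+1}\cdot M_{m,n}.$$
   Context: $K$ is a field of arbitrary characteristic, $R=K[[x_1,\ldots,x_s]]$ is the formal power series ring with maximal ideal $\mathfrak{m}$, and $M_{m,n}$ is the $R$-module of $m\times n$ matrices with entries in $R$. Groups and actions: $\mathcal{R}=\mathrm{Aut}(R)$ is the group of $K$-algebra automorphisms of $R$; $\mathcal{G}_l=GL(m,R)\rtimes\mathcal{R}$, $\mathcal{G}_r=GL(n,R)\rtimes\mathcal{R}$, $\mathcal{G}_{lr}=(GL(m,R)\times GL(n,R))\rtimes\mathcal{R}$. They act on $M_{m,n}$ by $\phi(A)=[\phi(a_{ij})]$, $U\cdot\phi(A)$, $\phi(A)\cdot V$, $U\cdot\phi(A)\cdot V$, respectively. Jets: $\mathrm{jet}_k(A)$ is the class of $A$ in $M^{(k)}_{m,n}=M_{m,n}/\mathfrak{m}^{k+1}M_{m,n}$. For $G$ one of these groups, $G^{(k)}=\{\mathrm{jet}_k(g)\mid g\in G\}$, where $\mathrm{jet}_k(U,V,\phi)=(\mathrm{jet}_k(U),\mathrm{jet}_k(V),\mathrm{jet}_k(\phi))$ with $\mathrm{jet}_k(\phi)(x_i)=\mathrm{jet}_k(\phi(x_i))$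 (similarly for the other groups); it is an affine algebraic group with $\mathrm{jet}_k(g)\mathrm{jet}_k(h)=\mathrm{jet}_k(gh)$, acting algebraically on the affine space $M^{(k)}_{m,n}$ by $(\mathrm{jet}_k(g),\mathrm{jet}_k(A))\mapsto\mathrm{jet}_k(gA)$, everything defined over $K$. The orbit map $G^{(k)}\to G^{(k)}\mathrm{jet}_k(A)$ sends $\mathrm{jet}_k(g)$ to $\mathrm{jet}_k(gA)$. Tangent spaces are Zariski tangent spaces over $K$ (tangent vectors at a $K$-rational point being $K[\epsilon]/(\epsilon^2)$-valued points over it; the orbit is formed over an algebraic closure of $K$ and is defined over $K$). Notation: $E_{m,pq}$ (resp. $E_{n,hl}$) is the $m\times m$ (resp. $n\times n$) matrix with $1$ at place $(p,q)$ (resp. $(h,l)$) and $0$ elsewhere; $\frac{\partial A}{\partial x_\nu}=[\frac{\partial a_{ij}}{\partial x_\nu}]$ for $A=[a_{ij}]$; $\langle E_{m,pq}\cdot A\rangle$, $\langle A\cdot E_{n,hl}\rangle$, $\langle\frac{\partial A}{\partial x_\nu}\rangle$ are the $R$-submodules of $M_{m,n}$ generated by all $E_{m,pq}A$ ($1\le p,q\le m$), all $AE_{n,hl}$ ($1\le h,l\le n$), all $\frac{\partial A}{\partial x_\nu}$ ($1\le\nu\le s$), respectively. *)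

theory Defs
  imports
    "HOL-Analysis.Finite_Cartesian_Product"
    "HOL-Library.Multiset"
    "HOL-Library.Poly_Mapping"
    "HOL-Library.Set_Algebras"
    "HOL-Computational_Algebra.Polynomial"
    "HOL-Algebra.Algebraic_Closure_Type"
begin

section \<open>Formal power series in several variables\<close>

text \<open>
  A monomial in the variables \<open>'v\<close> is a finite multiset over \<open>'v\<close>: the sum of multisets is the
  product of monomials, \<open>size\<close> is the total degree and \<open>count \<alpha> \<nu>\<close> the exponent of \<open>x\<^sub>\<nu>\<close>.
  The ring \<open>K[[x\<^sub>1, \<dots>, x\<^sub>s]]\<close> is \<open>('v, 'k) mfps\<close> with \<open>s = CARD('v)\<close>.
\<close>

typedef ('v, 'a) mfps = "UNIV :: ('v multiset \<Rightarrow> 'a) set"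
  morphisms mcoeff Abs_mfps by simp

setup_lifting type_definition_mfps

lemma mfps_eqI: "(\<And>\<alpha>. mcoeff f \<alpha> = mcoeff g \<alpha>) \<Longrightarrow> f = g"
  by transfer auto

definition splits :: "'v multiset \<Rightarrow> ('v multiset \<times> 'v multiset) set" where
  "splits \<alpha> = {(\<beta>, \<gamma>). \<beta> + \<gamma> = \<alpha>}"

lemma finite_splits [simp]: "finite (splits \<alpha>)"
proof -
  have "finite (\<Union>n\<le>size \<alpha>. multisets_of_size (set_mset \<alpha>) n)" (is "finite ?S")
    by auto
  moreover have "splits \<alpha> \<subseteq> ?S \<times> ?S"
    by (auto simp: splits_def multisets_of_size_def)
  ultimately show ?thesis
    by (meson finite_SigmaI finite_subset)
qed

instantiation mfps :: (type, comm_ring_1) comm_ring_1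
begin

lift_definition zero_mfps :: "('a, 'b) mfps" is "\<lambda>_. 0" .
lift_definition one_mfps :: "('a, 'b) mfps" is "\<lambda>\<alpha>. if \<alpha> = {#} then 1 else 0" .
lift_definition plus_mfps :: "('a, 'b) mfps \<Rightarrow> ('a, 'b) mfps \<Rightarrow> ('a, 'b) mfps"
  is "\<lambda>f g \<alpha>. f \<alpha> + g \<alpha>" .
lift_definition minus_mfps :: "('a, 'b) mfps \<Rightarrow> ('a, 'b) mfps \<Rightarrow> ('a, 'b) mfps"
  is "\<lambda>f g \<alpha>. f \<alpha> - g \<alpha>" .
lift_definition uminus_mfps :: "('a, 'b) mfps \<Rightarrow> ('a, 'b) mfps"
  is "\<lambda>f \<alpha>. - f \<alpha>" .
lift_definition times_mfps :: "('a, 'b) mfps \<Rightarrow> ('a, 'b) mfps \<Rightarrow> ('a, 'b) mfps"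
  is "\<lambda>f g \<alpha>. \<Sum>(\<beta>, \<gamma>)\<in>splits \<alpha>. f \<beta> * g \<gamma>" .

instance
proof
  fix f g h :: "('a, 'b) mfps"
  show "f * g * h = f * (g * h)"
  proof (rule mfps_eqI)
    fix \<alpha>
    have "mcoeff (f * g * h) \<alpha> =
        (\<Sum>(p, q)\<in>Sigma (splits \<alpha>) (\<lambda>(\<beta>, \<gamma>). splits \<beta>).
           mcoeff f (fst q) * mcoeff g (snd q) * mcoeff h (snd p))"
      by (simp add: times_mfps.rep_eq case_prod_unfold sum_distrib_right sum.Sigma)
    also have "\<dots> = (\<Sum>(p, q)\<in>Sigma (splits \<alpha>) (\<lambda>(\<beta>, \<gamma>). splits \<gamma>).
           mcoeff f (fst p) * (mcoeff g (fst q) * mcoeff h (snd q)))"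
      by (rule sum.reindex_bij_witness[of _
            "\<lambda>(p, q). ((fst p + fst q, snd q), (fst p, fst q))"
            "\<lambda>(p, q). ((fst q, snd q + snd p), (snd q, snd p))"])
         (auto simp: splits_def mult.assoc add.assoc)
    also have "\<dots> = mcoeff (f * (g * h)) \<alpha>"
      by (simp add: times_mfps.rep_eq case_prod_unfold sum_distrib_left sum.Sigma)
    finally show "mcoeff (f * g * h) \<alpha> = mcoeff (f * (g * h)) \<alpha>" .
  qed
  show "f * g = g * f"
  proof (rule mfps_eqI)
    fix \<alpha>
    show "mcoeff (f * g) \<alpha> = mcoeff (g * f) \<alpha>"
      unfolding times_mfps.rep_eq
      by (rule sum.reindex_bij_witness[of _ prod.swap prod.swap])
         (auto simp: splits_def add.commute mult.commute)
  qed
  show "1 * f = f"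
  proof (rule mfps_eqI)
    fix \<alpha>
    have "mcoeff (1 * f) \<alpha> = (\<Sum>(\<beta> :: 'a multiset, \<gamma>)\<in>{({#}, \<alpha>)}. mcoeff f \<gamma>)"
      unfolding times_mfps.rep_eq one_mfps.rep_eq
      by (rule sum.mono_neutral_cong_right[OF finite_splits]) (auto simp: splits_def split: if_splits)
    then show "mcoeff (1 * f) \<alpha> = mcoeff f \<alpha>" by simp
  qed
  show "(f + g) * h = f * h + g * h"
    by (rule mfps_eqI)
       (simp add: times_mfps.rep_eq plus_mfps.rep_eq case_prod_unfold distrib_right sum.distrib)
  show "f + g + h = f + (g + h)" by transfer (simp add: add.assoc)
  show "f + g = g + f" by transfer (simp add: add.commute)
  show "0 + f = f" by transfer simp
  show "- f + f = 0" by transfer simp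
  show "f - g = f + - g" by transfer simp
  show "(0 :: ('a, 'b) mfps) \<noteq> 1" by transfer (metis zero_neq_one)
qed

end

lift_definition mconst :: "'a::zero \<Rightarrow> ('v, 'a) mfps"
  is "\<lambda>c \<alpha>. if \<alpha> = {#} then c else 0" .

lift_definition mvar :: "'v \<Rightarrow> ('v, 'a::zero_neq_one) mfps"
  is "\<lambda>\<nu> \<alpha>. if \<alpha> = {#\<nu>#} then 1 else 0" .

lift_definition mderiv :: "'v \<Rightarrow> ('v, 'a::comm_ring_1) mfps \<Rightarrow> ('v, 'a) mfps"
  is "\<lambda>\<nu> f \<alpha>. of_nat (count \<alpha> \<nu> + 1) * f (add_mset \<nu> \<alpha>)" .

lift_definition map_mfps :: "('a \<Rightarrow> 'b) \<Rightarrow> ('v, 'a) mfps \<Rightarrow> ('v, 'b) mfps"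
  is "\<lambda>h f \<alpha>. h (f \<alpha>)" .


section \<open>Ideals of \<open>R\<close> and submodules of the matrix module\<close>

text \<open>The type \<open>R ^ 'n ^ 'm\<close> consists of the matrices with rows indexed by \<open>'m\<close> and columns by
  \<open>'n\<close>.\<close>

definition mscale :: "'r::comm_ring_1 \<Rightarrow> 'r ^ 'n ^ 'm \<Rightarrow> 'r ^ 'n ^ 'm" where
  "mscale r A = (\<chi> i j. r * A $ i $ j)"

global_interpretation matrix_module: Modules.module "mscale :: 'r::comm_ring_1 \<Rightarrow> 'r ^ 'n ^ 'm \<Rightarrow> _"
  by unfold_locales (auto simp: mscale_def vec_eq_iff algebra_simps)

global_interpretation ring_module: Modules.module "(*) :: 'r::comm_ring_1 \<Rightarrow> 'r \<Rightarrow> 'r"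
  by unfold_locales (auto simp: algebra_simps)

definition max_ideal :: "('v, 'k::field) mfps set" where
  "max_ideal = {f. mcoeff f {#} = 0}"

definition ideal_prod :: "'r::comm_ring_1 set \<Rightarrow> 'r set \<Rightarrow> 'r set" where
  "ideal_prod I J = ring_module.span {a * b |a b. a \<in> I \<and> b \<in> J}"

definition ideal_power :: "'r::comm_ring_1 set \<Rightarrow> nat \<Rightarrow> 'r set" where
  "ideal_power I n = (ideal_prod I ^^ n) UNIV"

definition ideal_smult :: "'r::comm_ring_1 set \<Rightarrow> ('r ^ 'n ^ 'm) set \<Rightarrow> ('r ^ 'n ^ 'm) set" where
  "ideal_smult I N = matrix_module.span {mscale a B |a B. a \<in> I \<and> B \<in> N}"

definition matrix_unit :: "'m \<Rightarrow> 'm \<Rightarrow> 'r::comm_ring_1 ^ 'm ^ 'm" where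
  "matrix_unit p q = (\<chi> i j. if i = p \<and> j = q then 1 else 0)"

definition map_matrix :: "('r \<Rightarrow> 's) \<Rightarrow> 'r ^ 'n ^ 'm \<Rightarrow> 's ^ 'n ^ 'm" where
  "map_matrix h A = (\<chi> i j. h (A $ i $ j))"

definition left_module :: "('v, 'k::field) mfps ^ 'n ^ 'm \<Rightarrow> (('v, 'k) mfps ^ 'n ^ 'm) set" where
  "left_module A = matrix_module.span {matrix_unit p q ** A |p q. True}"

definition right_module :: "('v, 'k::field) mfps ^ 'n ^ 'm \<Rightarrow> (('v, 'k) mfps ^ 'n ^ 'm) set" where
  "right_module A = matrix_module.span {A ** matrix_unit h l |h l. True}"

definition deriv_module :: "('v, 'k::field) mfps ^ 'n ^ 'm \<Rightarrow> (('v, 'k) mfps ^ 'n ^ 'm) set" where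
  "deriv_module A = matrix_module.span {map_matrix (mderiv \<nu>) A |\<nu>. True}"


section \<open>Jets\<close>

text \<open>\<open>jet_kernel k\<close> is the submodule \<open>\<mm>\<^bsup>k+1\<^esup> M\<close>, and \<open>jet k A\<close> is the residue class of \<open>A\<close>
  modulo it.\<close>

definition jet_kernel :: "nat \<Rightarrow> (('v, 'k::field) mfps ^ 'n ^ 'm) set" where
  "jet_kernel k = ideal_smult (ideal_power max_ideal (k + 1)) UNIV"

definition jet :: "nat \<Rightarrow> ('v, 'k::field) mfps ^ 'n ^ 'm \<Rightarrow> (('v, 'k) mfps ^ 'n ^ 'm) set" where
  "jet k A = {B. B - A \<in> jet_kernel k}"

text \<open>
  The affine coordinates of a \<open>k\<close>-jet are its coefficients of degree at most \<open>k\<close>. To avoid an index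
  type depending on \<open>k\<close>, coordinate vectors are indexed by all monomials and vanish at those of
  degree exceeding \<open>k\<close>. These superfluous coordinate functions vanish on every variety below,
  hence so do the corresponding components of every tangent vector. The jet of an
  automorphism \<open>\<phi>\<close> is given by the jets of the series \<open>\<phi> x\<^sub>\<nu>\<close>.
\<close>

definition mat_coords ::
  "nat \<Rightarrow> ('v, 'a::zero) mfps ^ 'n ^ 'm \<Rightarrow> 'm \<times> 'n \<times> 'v multiset \<Rightarrow> 'a" where
  "mat_coords k A = (\<lambda>(i, j, \<alpha>). if size \<alpha> \<le> k then mcoeff (A $ i $ j) \<alpha> else 0)"

definition aut_coords ::
  "nat \<Rightarrow> (('v, 'a::zero_neq_one) mfps \<Rightarrow> ('v, 'a) mfps) \<Rightarrow> 'v \<times> 'v multiset \<Rightarrow> 'a" where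
  "aut_coords k \<phi> = (\<lambda>(\<nu>, \<alpha>). if size \<alpha> \<le> k then mcoeff (\<phi> (mvar \<nu>)) \<alpha> else 0)"


section \<open>The groups and their actions\<close>

type_synonym ('v, 'k) endo = "('v, 'k) mfps \<Rightarrow> ('v, 'k) mfps"

definition grp_R :: "('v, 'k::field) endo set" where
  "grp_R = {\<phi>. bij \<phi> \<and> \<phi> 1 = 1 \<and> (\<forall>f g. \<phi> (f + g) = \<phi> f + \<phi> g) \<and>
     (\<forall>f g. \<phi> (f * g) = \<phi> f * \<phi> g) \<and> (\<forall>c f. \<phi> (mconst c * f) = mconst c * \<phi> f)}"

definition grp_l :: "((('v, 'k::field) mfps ^ 'm ^ 'm) \<times> ('v, 'k) endo) set" where
  "grp_l = {U. invertible U} \<times> grp_R"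

definition grp_r :: "((('v, 'k::field) mfps ^ 'n ^ 'n) \<times> ('v, 'k) endo) set" where
  "grp_r = {V. invertible V} \<times> grp_R"

definition grp_lr ::
  "((('v, 'k::field) mfps ^ 'm ^ 'm) \<times> (('v, 'k) mfps ^ 'n ^ 'n) \<times> ('v, 'k) endo) set" where
  "grp_lr = {U. invertible U} \<times> {V. invertible V} \<times> grp_R"

definition act_R ::
  "('v, 'k::field) endo \<Rightarrow> ('v, 'k) mfps ^ 'n ^ 'm \<Rightarrow> ('v, 'k) mfps ^ 'n ^ 'm" where
  "act_R \<phi> A = map_matrix \<phi> A"

definition act_l ::
  "(('v, 'k::field) mfps ^ 'm ^ 'm) \<times> ('v, 'k) endo \<Rightarrow>
   ('v, 'k) mfps ^ 'n ^ 'm \<Rightarrow> ('v, 'k) mfps ^ 'n ^ 'm" where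
  "act_l = (\<lambda>(U, \<phi>) A. U ** map_matrix \<phi> A)"

definition act_r ::
  "(('v, 'k::field) mfps ^ 'n ^ 'n) \<times> ('v, 'k) endo \<Rightarrow>
   ('v, 'k) mfps ^ 'n ^ 'm \<Rightarrow> ('v, 'k) mfps ^ 'n ^ 'm" where
  "act_r = (\<lambda>(V, \<phi>) A. map_matrix \<phi> A ** V)"

definition act_lr ::
  "(('v, 'k::field) mfps ^ 'm ^ 'm) \<times> (('v, 'k) mfps ^ 'n ^ 'n) \<times> ('v, 'k) endo \<Rightarrow>
   ('v, 'k) mfps ^ 'n ^ 'm \<Rightarrow> ('v, 'k) mfps ^ 'n ^ 'm" where
  "act_lr = (\<lambda>(U, V, \<phi>) A. U ** map_matrix \<phi> A ** V)"

definition coords_R :: "nat \<Rightarrow> ('v, 'k::field) endo \<Rightarrow> 'v \<times> 'v multiset \<Rightarrow> 'k" where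
  "coords_R k \<phi> = aut_coords k \<phi>"

definition coords_l ::
  "nat \<Rightarrow> (('v, 'k::field) mfps ^ 'm ^ 'm) \<times> ('v, 'k) endo \<Rightarrow>
   'm \<times> 'm \<times> 'v multiset + 'v \<times> 'v multiset \<Rightarrow> 'k" where
  "coords_l k = (\<lambda>(U, \<phi>). case_sum (mat_coords k U) (aut_coords k \<phi>))"

definition coords_r ::
  "nat \<Rightarrow> (('v, 'k::field) mfps ^ 'n ^ 'n) \<times> ('v, 'k) endo \<Rightarrow>
   'n \<times> 'n \<times> 'v multiset + 'v \<times> 'v multiset \<Rightarrow> 'k" where
  "coords_r k = (\<lambda>(V, \<phi>). case_sum (mat_coords k V) (aut_coords k \<phi>))"

definition coords_lr ::
  "nat \<Rightarrow> (('v, 'k::field) mfps ^ 'm ^ 'm) \<times> (('v, 'k) mfps ^ 'n ^ 'n) \<times> ('v, 'k) endo \<Rightarrow>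
   'm \<times> 'm \<times> 'v multiset + 'n \<times> 'n \<times> 'v multiset + 'v \<times> 'v multiset \<Rightarrow> 'k" where
  "coords_lr k = (\<lambda>(U, V, \<phi>).
     case_sum (mat_coords k U) (case_sum (mat_coords k V) (aut_coords k \<phi>)))"


section \<open>Zariski tangent spaces and tangent maps\<close>

text \<open>
  \<open>'i multiset \<Rightarrow>\<^sub>0 'k\<close> is the polynomial ring over \<open>'k\<close> in the variables \<open>'i\<close>. The value of a
  polynomial at a point with coordinates in a \<open>'k\<close>-algebra with structure map \<open>h\<close>:
\<close>

definition poly_val ::
  "('k::zero \<Rightarrow> 'b::comm_semiring_1) \<Rightarrow> ('i \<Rightarrow> 'b) \<Rightarrow> ('i multiset \<Rightarrow>\<^sub>0 'k) \<Rightarrow> 'b" where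
  "poly_val h p F =
     (\<Sum>\<alpha>\<in>Poly_Mapping.keys F. h (Poly_Mapping.lookup F \<alpha>) * prod_mset (image_mset p \<alpha>))"

text \<open>
  The dual numbers \<open>K[\<epsilon>]/(\<epsilon>\<^sup>2)\<close> are the residue classes modulo \<open>t\<^sup>2\<close> in the polynomial ring \<open>'k poly\<close>
  in one variable \<open>t\<close>; the value of \<open>F\<close> at \<open>p + \<epsilon> v\<close> is the class of the following polynomial.
\<close>

definition dual_val ::
  "('i \<Rightarrow> 'k::field) \<Rightarrow> ('i \<Rightarrow> 'k) \<Rightarrow> ('i multiset \<Rightarrow>\<^sub>0 'k) \<Rightarrow> 'k poly" where
  "dual_val p v F = poly_val (\<lambda>c. [:c:]) (\<lambda>i. [:p i, v i:]) F"

text \<open>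
  A locally closed subvariety \<open>S\<close> of affine space that is defined over \<open>K\<close> is given by its points over
  the algebraic closure. Its tangent space at a \<open>K\<close>-rational point \<open>p\<close> of \<open>S\<close> consists of the \<open>v\<close> such
  that \<open>p + \<epsilon> v\<close> satisfies all equations over \<open>K\<close> of the closure of \<open>S\<close>; the inequalities defining \<open>S\<close>
  in its closure hold at \<open>p + \<epsilon> v\<close> since they hold at \<open>p\<close>.
\<close>

definition tangent_space ::
  "('i \<Rightarrow> 'k::field alg_closure) set \<Rightarrow> ('i \<Rightarrow> 'k) \<Rightarrow> ('i \<Rightarrow> 'k) set" where
  "tangent_space S p =
     {v. \<forall>F. (\<forall>x\<in>S. poly_val to_ac x F = 0) \<longrightarrow> Polynomial.monom 1 2 dvd dual_val p v F}"

text \<open>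
  For a map \<open>f\<close> on \<open>S\<close> that is given by polynomials \<open>P\<close> over \<open>K\<close>, the tangent map at \<open>p\<close> sends \<open>v\<close> to the
  coefficient of \<open>\<epsilon>\<close> in \<open>P (p + \<epsilon> v)\<close>. On the tangent space of \<open>S\<close> this does not depend on the choice of
  \<open>P\<close>.
\<close>

definition tangent_map ::
  "('i \<Rightarrow> 'k::field alg_closure) set \<Rightarrow> (('i \<Rightarrow> 'k alg_closure) \<Rightarrow> 'j \<Rightarrow> 'k alg_closure) \<Rightarrow>
   ('i \<Rightarrow> 'k) \<Rightarrow> ('i \<Rightarrow> 'k) \<Rightarrow> 'j \<Rightarrow> 'k" where
  "tangent_map S f p v =
     (THE w. \<exists>P. (\<forall>x\<in>S. \<forall>j. f x j = poly_val to_ac x (P j)) \<and>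
                 (\<forall>j. w j = Polynomial.coeff (dual_val p v (P j)) 1))"


section \<open>Orbit maps and tangent images\<close>

text \<open>
  In the following, \<open>G\<close> is one of the groups above, formed over the algebraic closure, \<open>act\<close> is
  its action, \<open>crd\<close> maps \<open>g\<close> to the coordinates of its \<open>k\<close>-jet (so that \<open>crd ` G\<close> is the variety
  \<open>G\<^bsup>(k)\<^esup>\<close>) and \<open>e\<close> are the coordinates of the identity. The matrix \<open>A\<close> has entries over \<open>K\<close>.
\<close>

definition base_change ::
  "('v, 'k::field) mfps ^ 'n ^ 'm \<Rightarrow> ('v, 'k alg_closure) mfps ^ 'n ^ 'm" where
  "base_change A = map_matrix (map_mfps to_ac) A"

definition jet_orbit ::
  "'g set \<Rightarrow> ('g \<Rightarrow> ('v, 'k::field alg_closure) mfps ^ 'n ^ 'm \<Rightarrow> ('v, 'k alg_closure) mfps ^ 'n ^ 'm) \<Rightarrow>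
   nat \<Rightarrow> ('v, 'k) mfps ^ 'n ^ 'm \<Rightarrow> ('m \<times> 'n \<times> 'v multiset \<Rightarrow> 'k alg_closure) set" where
  "jet_orbit G act k A = {mat_coords k (act g (base_change A)) |g. g \<in> G}"

definition orbit_map ::
  "'g set \<Rightarrow> ('g \<Rightarrow> 'i \<Rightarrow> 'k::field alg_closure) \<Rightarrow>
   ('g \<Rightarrow> ('v, 'k alg_closure) mfps ^ 'n ^ 'm \<Rightarrow> ('v, 'k alg_closure) mfps ^ 'n ^ 'm) \<Rightarrow>
   nat \<Rightarrow> ('v, 'k) mfps ^ 'n ^ 'm \<Rightarrow>
   ('i \<Rightarrow> 'k alg_closure) \<Rightarrow> 'm \<times> 'n \<times> 'v multiset \<Rightarrow> 'k alg_closure" where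
  "orbit_map G crd act k A x =
     (THE y. \<exists>g\<in>G. x = crd g \<and> y = mat_coords k (act g (base_change A)))"

definition orbit_tangent_map ::
  "'g set \<Rightarrow> ('g \<Rightarrow> 'i \<Rightarrow> 'k::field alg_closure) \<Rightarrow> ('i \<Rightarrow> 'k) \<Rightarrow>
   ('g \<Rightarrow> ('v, 'k alg_closure) mfps ^ 'n ^ 'm \<Rightarrow> ('v, 'k alg_closure) mfps ^ 'n ^ 'm) \<Rightarrow>
   nat \<Rightarrow> ('v, 'k) mfps ^ 'n ^ 'm \<Rightarrow> ('i \<Rightarrow> 'k) \<Rightarrow> 'm \<times> 'n \<times> 'v multiset \<Rightarrow> 'k" where
  "orbit_tangent_map G crd e act k A = tangent_map (crd ` G) (orbit_map G crd act k A) e"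

text \<open>The tangent map takes values in the tangent space of the orbit.\<close>

definition orbit_tangent_map_welldef ::
  "'g set \<Rightarrow> ('g \<Rightarrow> 'i \<Rightarrow> 'k::field alg_closure) \<Rightarrow> ('i \<Rightarrow> 'k) \<Rightarrow>
   ('g \<Rightarrow> ('v, 'k alg_closure) mfps ^ 'n ^ 'm \<Rightarrow> ('v, 'k alg_closure) mfps ^ 'n ^ 'm) \<Rightarrow>
   nat \<Rightarrow> ('v, 'k) mfps ^ 'n ^ 'm \<Rightarrow> bool" where
  "orbit_tangent_map_welldef G crd e act k A \<longleftrightarrow>
     (\<forall>v \<in> tangent_space (crd ` G) e.
        orbit_tangent_map G crd e act k A v \<in> tangent_space (jet_orbit G act k A) (mat_coords k A))"

text \<open>The image of the tangent map, as a set of elements of \<open>M\<^bsup>(k)\<^esup>\<close>, i.e. of residue classes: the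
  tangent space of the affine space \<open>M\<^bsup>(k)\<^esup>\<close> is identified with \<open>M\<^bsup>(k)\<^esup>\<close> by means of the
  coordinates.\<close>

definition tangent_image ::
  "'g set \<Rightarrow> ('g \<Rightarrow> 'i \<Rightarrow> 'k::field alg_closure) \<Rightarrow> ('i \<Rightarrow> 'k) \<Rightarrow>
   ('g \<Rightarrow> ('v, 'k alg_closure) mfps ^ 'n ^ 'm \<Rightarrow> ('v, 'k alg_closure) mfps ^ 'n ^ 'm) \<Rightarrow>
   nat \<Rightarrow> ('v, 'k) mfps ^ 'n ^ 'm \<Rightarrow> (('v, 'k) mfps ^ 'n ^ 'm) set set" where
  "tangent_image G crd e act k A =
     {jet k B |B. mat_coords k B \<in> orbit_tangent_map G crd e act k A ` tangent_space (crd ` G) e}"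

end

theory Submission
  imports Defs
begin

text \<open>
  The tangent space of \<open>G\<^bsup>(k)\<^esup>\<close> at \<open>e\<close> consists of all vectors supported on the coordinates that are
  not identically zero on \<open>G\<^bsup>(k)\<^esup>\<close>. For a coordinate direction \<open>v\<close>, the points \<open>e + t v\<close> with
  \<open>t \<noteq> - 1\<close> are jets of elementary group elements: \<open>I + t x\<^sup>\<alpha> E\<^sub>p\<^sub>q\<close>, or the automorphism
  \<open>x\<^sub>\<nu> \<mapsto> x\<^sub>\<nu> + t x\<^sup>\<alpha>\<close>. An equation of \<open>G\<^bsup>(k)\<^esup>\<close> restricted to such a line is a polynomial in \<open>t\<close>
  with infinitely many roots in the algebraic closure, hence zero. As the tangent space is linear,
  coordinate directions suffice.

  The orbit map is polynomial because \<open>\<phi> f\<close> is the substitution of the series \<open>\<phi> x\<^sub>\<nu>\<close> into \<open>f\<close>. Evaluated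
  over the dual numbers at \<open>(I + \<epsilon> U, I + \<epsilon> V, x\<^sub>\<nu> + \<epsilon> w\<^sub>\<nu>)\<close>, its \<open>\<epsilon>\<close>-part is
  \<open>U A + A V + \<Sum>\<^sub>\<nu> w\<^sub>\<nu> \<partial>A/\<partial>x\<^sub>\<nu>\<close>; letting \<open>U\<close> and \<open>V\<close> be arbitrary and \<open>w\<^sub>\<nu> \<in> \<mm>\<close> gives the four submodules.
\<close>

text \<open>Elements of \<open>grp_R\<close> are abstract K-algebra automorphisms; continuity is not
  part of the definition and has to be derived. An automorphism maps nonunits to nonunits, so it
  preserves \<mm> and all its powers, and is therefore determined on all of R by its values on the
  variables. This makes the orbit map polynomial. It also explains the factor \<mm> in front of the
  derivatives: the constant coefficients of the series \<phi> x_\<nu> vanish on the whole group of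
  jets.

  The value t = -1 is excluded because I + t E_pp has determinant 1 + t and x_\<nu> \<mapsto>
  x_\<nu> + t x_\<nu> is scaling by 1 + t. One missing value is harmless on an infinite line, and
  the lines are taken over the algebraic closure because K itself may be finite.

  Differentials are computed over the dual numbers by the Leibniz rule alone, without division by
  integers, so the argument is uniform in the characteristic. The assumption k \<ge> 1 ensures that
  the jet of the identity still contains the linear terms x_\<nu>.\<close>

no_notation fps_nth (infixl \<open>$\<close> 75)
no_notation AbelCoset.set_add (infixl \<open><+>\<index>\<close> 60)

declare ring_module.scale_scale [simp del] \<comment> \<open>would rewrite against \<open>mult.assoc\<close>\<close>

section \<open>Power series and the order filtration\<close>

lemmas mcoeff_simps [simp] = zero_mfps.rep_eq plus_mfps.rep_eq minus_mfps.rep_eq uminus_mfps.rep_eq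
  one_mfps.rep_eq mconst.rep_eq map_mfps.rep_eq mderiv.rep_eq Abs_mfps_inverse[OF UNIV_I]

lemma mcoeff_mult: "mcoeff (f * g) \<alpha> = (\<Sum>(\<beta>, \<gamma>)\<in>splits \<alpha>. mcoeff f \<beta> * mcoeff g \<gamma>)"
  by (simp add: times_mfps.rep_eq)

lemma mcoeff_sum: "mcoeff (sum f A) \<alpha> = (\<Sum>x\<in>A. mcoeff (f x) \<alpha>)"
  by (induction A rule: infinite_finite_induct) auto

lemma splits_empty: "splits {#} = {({#}, {#})}"
  by (auto simp: splits_def)

lemma mcoeff_mult_empty: "mcoeff (f * g) {#} = mcoeff f {#} * mcoeff g {#}"
  by (simp add: mcoeff_mult splits_empty)

lemma mcoeff_mconst_mult [simp]:
  "mcoeff (mconst c * f :: ('b, 'a::comm_ring_1) mfps) \<alpha> = c * mcoeff f \<alpha>"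
proof -
  have "mcoeff (mconst c * f) \<alpha> = (\<Sum>(\<beta> :: 'b multiset, \<gamma>)\<in>{({#}, \<alpha>)}. c * mcoeff f \<gamma>)"
    unfolding mcoeff_mult mcoeff_simps
    by (rule sum.mono_neutral_cong_right[OF finite_splits]) (auto simp: splits_def split: if_splits)
  then show ?thesis by simp
qed

lemma mconst_1 [simp]: "mconst 1 = 1"
  and mconst_mult: "mconst (a * b) = mconst a * (mconst b :: ('v, 'a::comm_ring_1) mfps)"
  and mconst_add: "mconst (a + b) = mconst a + (mconst b :: ('v, 'a) mfps)"
  by (auto intro!: mfps_eqI)

lemma mcoeff_mvar_mult:
  "mcoeff (mvar \<nu> * f) \<alpha> = (if \<nu> \<in># \<alpha> then mcoeff f (\<alpha> - {#\<nu>#}) else 0)"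
proof -
  have "mcoeff (mvar \<nu> * f) \<alpha> =
      (\<Sum>(\<beta>, \<gamma>)\<in>(if \<nu> \<in># \<alpha> then {({#\<nu>#}, \<alpha> - {#\<nu>#})} else {}). mcoeff f \<gamma>)"
    unfolding mcoeff_mult mvar.rep_eq
    by (rule sum.mono_neutral_cong_right[OF finite_splits]) (auto simp: splits_def split: if_splits)
  then show ?thesis by simp
qed

text \<open>The power product Y^\<beta>; \<open>mprod mvar \<beta>\<close> is the monomial
  x^\<beta>. It is the inner product in \<open>poly_val\<close> as well, so one set of rules serves
  polynomials and power series.\<close>

definition mprod :: "('v \<Rightarrow> 'r::comm_monoid_mult) \<Rightarrow> 'v multiset \<Rightarrow> 'r" where
  "mprod Y \<beta> = prod_mset (image_mset Y \<beta>)"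

lemma mprod_empty [simp]: "mprod Y {#} = 1"
  and mprod_add_mset [simp]: "mprod Y (add_mset \<nu> \<beta>) = Y \<nu> * mprod Y \<beta>"
  and mprod_union: "mprod Y (\<beta> + \<gamma>) = mprod Y \<beta> * mprod Y \<gamma>"
  by (auto simp: mprod_def)

lemma mcoeff_mprod_mvar: "mcoeff (mprod mvar \<beta>) \<gamma> = (if \<gamma> = \<beta> then 1 else 0)"
proof (induction \<beta> arbitrary: \<gamma>)
  case (add \<nu> \<beta>)
  then show ?case by (auto simp: mcoeff_mvar_mult)
qed auto

lemma finite_size_le [simp]: "finite {\<beta> :: 'v::finite multiset. size \<beta> \<le> n}"
proof -
  have "{\<beta> :: 'v multiset. size \<beta> \<le> n} = (\<Union>i\<le>n. multisets_of_size UNIV i)"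
    by (auto simp: multisets_of_size_def)
  then show ?thesis by auto
qed

text \<open>The power \<mm>^n described by coefficients; \<open>ideal_power_max_ideal\<close> below
  proves the agreement over a field. General coefficient rings are allowed because series over
  \<open>'k poly\<close>, standing for the dual numbers, are filtered too.\<close>

definition mord :: "nat \<Rightarrow> ('v, 'a::comm_ring_1) mfps set" where
  "mord n = {f. \<forall>\<alpha>. size \<alpha> < n \<longrightarrow> mcoeff f \<alpha> = 0}"

lemma mordI: "(\<And>\<alpha>. size \<alpha> < n \<Longrightarrow> mcoeff f \<alpha> = 0) \<Longrightarrow> f \<in> mord n"
  and mordD: "f \<in> mord n \<Longrightarrow> size \<alpha> < n \<Longrightarrow> mcoeff f \<alpha> = 0"
  by (auto simp: mord_def)

lemma mord_0 [simp]: "mord 0 = UNIV"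
  and zero_in_mord [simp]: "0 \<in> mord n"
  and mord_add: "f \<in> mord n \<Longrightarrow> g \<in> mord n \<Longrightarrow> f + g \<in> mord n"
  and mord_diff: "f \<in> mord n \<Longrightarrow> g \<in> mord n \<Longrightarrow> f - g \<in> mord n"
  and mord_uminus: "f \<in> mord n \<Longrightarrow> - f \<in> mord n"
  and mord_antimono: "f \<in> mord n \<Longrightarrow> m \<le> n \<Longrightarrow> f \<in> mord m"
  and max_ideal_eq_mord: "max_ideal = mord 1"
  by (auto simp: mord_def max_ideal_def)

lemma mord_sum: "(\<And>x. x \<in> A \<Longrightarrow> f x \<in> mord n) \<Longrightarrow> sum f A \<in> mord n"
  by (induction A rule: infinite_finite_induct) (auto intro: mord_add)

lemma mord_mult:
  assumes "f \<in> mord m" "g \<in> mord n"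
  shows "f * g \<in> mord (m + n)"
proof (rule mordI)
  fix \<alpha> :: "'a multiset" assume \<alpha>: "size \<alpha> < m + n"
  have "mcoeff f \<beta> * mcoeff g \<gamma> = 0" if "\<beta> + \<gamma> = \<alpha>" for \<beta> \<gamma>
  proof -
    from that \<alpha> have "size \<beta> < m \<or> size \<gamma> < n" by auto
    then show ?thesis using assms by (auto simp: mordD)
  qed
  then show "mcoeff (f * g) \<alpha> = 0"
    by (auto simp: mcoeff_mult splits_def intro!: sum.neutral)
qed

lemma mord_mult_left: "g \<in> mord n \<Longrightarrow> f * g \<in> mord n"
  and mord_mult_right: "g \<in> mord n \<Longrightarrow> g * f \<in> mord n"
  using mord_mult[of f 0 g n] mord_mult[of g n f 0] by auto

lemma mvar_in_mord: "mvar \<nu> \<in> mord 1"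
  by (rule mordI) (simp add: mvar.rep_eq)

lemma mprod_in_mord: "(\<And>\<nu>. Y \<nu> \<in> mord 1) \<Longrightarrow> mprod Y \<beta> \<in> mord (size \<beta>)"
proof (induction \<beta>)
  case (add \<nu> \<beta>)
  then show ?case using mord_mult[of "Y \<nu>" 1 "mprod Y \<beta>" "size \<beta>"] by simp
qed auto

lemma mprod_mvar_in_mord: "mprod mvar \<beta> \<in> mord (size \<beta>)"
  by (intro mprod_in_mord mvar_in_mord)

text \<open>Since \<open>mord n\<close> is an ideal, the factors can be exchanged one at a
  time.\<close>

lemma mord_mprod_cong:
  assumes "\<And>\<nu>. Y \<nu> - Z \<nu> \<in> mord n"
  shows "mprod Y \<beta> - mprod Z \<beta> \<in> mord n"
proof (induction \<beta>)
  case (add \<nu> \<beta>)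
  have "mprod Y (add_mset \<nu> \<beta>) - mprod Z (add_mset \<nu> \<beta>) =
      Y \<nu> * (mprod Y \<beta> - mprod Z \<beta>) + mprod Z \<beta> * (Y \<nu> - Z \<nu>)"
    by (simp add: algebra_simps)
  then show ?case using add assms by (simp add: mord_add mord_mult_left)
qed auto

text \<open>The \<mm>-adic topology is separated: the coefficient at \<alpha> is already determined
  modulo \<open>mord (Suc (size \<alpha>))\<close>.\<close>

lemma mfps_eqI_mord:
  assumes "\<And>n. f - g \<in> mord n"
  shows "f = g"
proof (rule mfps_eqI)
  fix \<alpha>
  show "mcoeff f \<alpha> = mcoeff g \<alpha>"
    using mordD[OF assms[of "Suc (size \<alpha>)"], of \<alpha>] by simp
qed

text \<open>Each nonconstant monomial is divided by one of its variables, chosen by \<open>s\<close>.\<close>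

lemma mord_Suc_decomp:
  fixes f :: "('v::finite, 'a::comm_ring_1) mfps"
  assumes "f \<in> mord (Suc n)"
  obtains g where "\<And>\<nu>. g \<nu> \<in> mord n" "f = (\<Sum>\<nu>\<in>UNIV. mvar \<nu> * g \<nu>)"
proof -
  have "\<exists>\<nu>. \<alpha> \<noteq> {#} \<longrightarrow> \<nu> \<in># \<alpha>" for \<alpha> :: "'v multiset"
    by (cases \<alpha>) auto
  then obtain s :: "'v multiset \<Rightarrow> 'v" where s: "\<alpha> \<noteq> {#} \<Longrightarrow> s \<alpha> \<in># \<alpha>" for \<alpha>
    by metis
  define g :: "'v \<Rightarrow> ('v, 'a) mfps" where
    "g = (\<lambda>\<nu>. Abs_mfps (\<lambda>\<gamma>. if s (add_mset \<nu> \<gamma>) = \<nu> then mcoeff f (add_mset \<nu> \<gamma>) else 0))"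
  have "g \<nu> \<in> mord n" for \<nu>
    using assms by (auto simp: g_def mord_def)
  moreover have "f = (\<Sum>\<nu>\<in>UNIV. mvar \<nu> * g \<nu>)"
  proof (rule mfps_eqI)
    fix \<alpha>
    show "mcoeff f \<alpha> = mcoeff (\<Sum>\<nu>\<in>UNIV. mvar \<nu> * g \<nu>) \<alpha>"
    proof (cases "\<alpha> = {#}")
      case True
      then show ?thesis using assms by (simp add: mcoeff_sum mcoeff_mvar_mult mordD)
    next
      case False
      have "mcoeff (mvar \<nu> * g \<nu>) \<alpha> = (if \<nu> = s \<alpha> then mcoeff f \<alpha> else 0)" for \<nu>
      proof (cases "\<nu> \<in># \<alpha>")
        case True
        then show ?thesis by (auto simp: mcoeff_mvar_mult g_def)
      next
        case not_in: False
        then show ?thesis using s[OF False] by (auto simp: mcoeff_mvar_mult)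
      qed
      then show ?thesis by (simp add: mcoeff_sum)
    qed
  qed
  ultimately show ?thesis by (rule that)
qed

text \<open>A solution of \<open>f + E f = g\<close> is the limit of the iteration \<open>f \<mapsto> g - E f\<close>.\<close>

lemma id_plus_bij:
  fixes E :: "('v, 'a::comm_ring_1) mfps \<Rightarrow> ('v, 'a) mfps"
  assumes diff: "\<And>f g. E (f - g) = E f - E g"
    and raise: "\<And>n f. f \<in> mord n \<Longrightarrow> E f \<in> mord (Suc n)"
  shows "bij (\<lambda>f. f + E f)"
proof (rule bijI)
  show "inj (\<lambda>f. f + E f)"
  proof (rule injI)
    fix f g assume eq: "f + E f = g + E g"
    have "f - g \<in> mord n" for n
    proof (induction n)
      case (Suc n)
      \<comment> \<open>The difference of two preimages is reproduced by -E, and each application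
        raises its order by one.\<close>
      have "f - g = - E (f - g)" using eq by (simp add: diff algebra_simps)
      then show ?case using raise[OF Suc] by (metis mord_uminus)
    qed simp
    then show "f = g" by (rule mfps_eqI_mord)
  qed
  have "\<exists>f. f + E f = g" for g
  proof -
    define F where "F = rec_nat 0 (\<lambda>_ f. g - E f)"
    have F0: "F 0 = 0" and FS: "F (Suc n) = g - E (F n)" for n
      by (auto simp: F_def)
    have step: "F (Suc n) - F n \<in> mord n" for n
    proof (induction n)
      case (Suc n)
      have "F (Suc (Suc n)) - F (Suc n) = - E (F (Suc n) - F n)"
        by (simp add: FS diff)
      then show ?case using raise[OF Suc] by (simp add: mord_uminus)
    qed simp
    have far: "F (n + j) - F n \<in> mord n" for n j
    proof (induction j)
      case (Suc j)
      have "F (n + Suc j) - F n = (F (Suc (n + j)) - F (n + j)) + (F (n + j) - F n)" by simp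
      then show ?case using Suc step[of "n + j"] by (metis le_add1 mord_add mord_antimono)
    qed simp
    \<comment> \<open>By \<open>far\<close>, the coefficient at \<gamma> is stationary from the
      index \<open>Suc (size \<gamma>)\<close> on.\<close>
    define f where "f = Abs_mfps (\<lambda>\<gamma>. mcoeff (F (Suc (size \<gamma>))) \<gamma>)"
    have close: "f - F n \<in> mord n" for n
    proof (rule mordI)
      fix \<gamma> :: "'v multiset" assume "size \<gamma> < n"
      then obtain j where "n = Suc (size \<gamma>) + j" by (metis Suc_leI le_iff_add)
      then show "mcoeff (f - F n) \<gamma> = 0"
        using mordD[OF far[of "Suc (size \<gamma>)" j], of \<gamma>] by (simp add: f_def)
    qed
    have "(f + E f) - g \<in> mord n" for n
    proof -
      have "(f + E f) - g = (f - F (Suc n)) + E (f - F n)"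
        by (simp add: FS diff)
      then show ?thesis
        using close[of "Suc n"] raise[OF close[of n]] by (metis le_SucI mord_add mord_antimono order_refl)
    qed
    then have "f + E f = g" by (rule mfps_eqI_mord)
    then show ?thesis ..
  qed
  then show "surj (\<lambda>f. f + E f)" by (metis surjI)
qed

text \<open>After scaling the constant term to 1, multiplication by the series is the identity plus
  multiplication by an element of \<mm>, which raises the order. This is the geometric series in the
  form of \<open>id_plus_bij\<close>.\<close>

lemma mfps_unit:
  fixes f :: "('v, 'k::field) mfps"
  assumes "mcoeff f {#} \<noteq> 0"
  obtains g where "f * g = 1"
proof -
  define u where "u = mconst (1 / mcoeff f {#}) * f"
  have u: "u - 1 \<in> mord 1"
    using assms by (intro mordI) (auto simp: u_def)
  have "bij (\<lambda>g. g + (u - 1) * g)"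
    by (rule id_plus_bij) (simp_all only: right_diff_distrib, use mord_mult[OF u] in simp)
  then obtain g where "g + (u - 1) * g = 1" by (metis bij_pointE)
  then have "u * g = 1" by (simp add: left_diff_distrib)
  then have "f * (mconst (1 / mcoeff f {#}) * g) = 1"
    unfolding u_def by (metis mult.assoc mult.commute)
  then show ?thesis by (rule that)
qed

text \<open>The inclusion of \<open>mord (Suc n)\<close> in the product rests on
  \<open>mord_Suc_decomp\<close>: with finitely many variables, a series of order n + 1 is a finite
  sum of products x_\<nu> g_\<nu> with g_\<nu> of order n.\<close>

lemma ideal_prod_max_mord:
  "ideal_prod max_ideal (mord n) = (mord (Suc n) :: ('v::finite, 'k::field) mfps set)"
proof
  have "ring_module.subspace (mord (Suc n) :: ('v, 'k) mfps set)"
    by (auto simp: ring_module.subspace_def mord_add mord_mult_left)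
  then show "ideal_prod max_ideal (mord n) \<subseteq> (mord (Suc n) :: ('v, 'k) mfps set)"
    unfolding ideal_prod_def max_ideal_eq_mord
    by (intro ring_module.span_minimal) (use mord_mult[of _ 1 _ n] in auto)
  show "(mord (Suc n) :: ('v, 'k) mfps set) \<subseteq> ideal_prod max_ideal (mord n)"
  proof
    fix f :: "('v, 'k) mfps" assume "f \<in> mord (Suc n)"
    then obtain g where g: "\<And>\<nu>. g \<nu> \<in> mord n" and f: "f = (\<Sum>\<nu>\<in>UNIV. mvar \<nu> * g \<nu>)"
      using mord_Suc_decomp by blast
    have "mvar \<nu> * g \<nu> \<in> {a * b |a b. a \<in> mord 1 \<and> b \<in> mord n}" for \<nu>
      using mvar_in_mord[of \<nu>] g[of \<nu>] by (intro CollectI exI conjI) (rule refl)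
    then show "f \<in> ideal_prod max_ideal (mord n)"
      unfolding ideal_prod_def max_ideal_eq_mord f
      by (intro ring_module.span_sum ring_module.span_base)
  qed
qed

lemma ideal_power_max_ideal: "ideal_power max_ideal n = (mord n :: ('v::finite, 'k::field) mfps set)"
proof (induction n)
  case (Suc n)
  then show ?case by (simp add: ideal_power_def ideal_prod_max_mord)
qed (simp add: ideal_power_def)

section \<open>Base change and substitution\<close>

text \<open>One interface for all homomorphisms of the proof: the embedding \<open>to_ac\<close>,
  values of polynomials, reduction modulo \<epsilon>, substitutions and automorphisms.\<close>

locale ring_morphism =
  fixes h :: "'a::comm_ring_1 \<Rightarrow> 'b::comm_ring_1"
  assumes hom_add: "h (x + y) = h x + h y"
    and hom_mult: "h (x * y) = h x * h y"
    and hom_one: "h 1 = 1"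
begin

lemma hom_zero: "h 0 = 0"
  using hom_add[of 0 0] by simp

lemma hom_sum: "h (sum f A) = (\<Sum>x\<in>A. h (f x))"
  by (induction A rule: infinite_finite_induct) (auto simp: hom_zero hom_add)

lemma hom_mprod: "h (mprod Y \<beta>) = mprod (\<lambda>\<nu>. h (Y \<nu>)) \<beta>"
  by (induction \<beta>) (auto simp: hom_one hom_mult)

lemma map_matrix_mult: "map_matrix h (A ** B) = map_matrix h A ** map_matrix h B"
  by (simp add: map_matrix_def matrix_matrix_mult_def vec_eq_iff hom_sum hom_mult)

lemma map_mfps_morphism: "ring_morphism (map_mfps h :: ('v, 'a) mfps \<Rightarrow> ('v, 'b) mfps)"
proof
  fix f g :: "('v, 'a) mfps"
  show "map_mfps h (f + g) = map_mfps h f + map_mfps h g"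
    by (rule mfps_eqI) (simp add: hom_add)
  show "map_mfps h (f * g) = map_mfps h f * map_mfps h g"
    by (rule mfps_eqI) (simp add: mcoeff_mult hom_sum hom_mult case_prod_unfold)
  show "map_mfps h 1 = (1 :: ('v, 'b) mfps)"
    by (rule mfps_eqI) (simp add: hom_one hom_zero)
qed

end

text \<open>The cutoff \<open>size \<beta> \<le> size \<gamma>\<close> makes every coefficient a
  finite sum, so the operation is defined for all Y. It is genuine substitution when the series Y
  have no constant term, since then Y^\<beta> has order at least
  \<open>size \<beta>\<close>.\<close>

definition msubst ::
  "('v \<Rightarrow> ('w, 'a::comm_ring_1) mfps) \<Rightarrow> ('v::finite, 'a) mfps \<Rightarrow> ('w, 'a) mfps" where
  "msubst Y f =
     Abs_mfps (\<lambda>\<gamma>. \<Sum>\<beta> | size \<beta> \<le> size \<gamma>. mcoeff f \<beta> * mcoeff (mprod Y \<beta>) \<gamma>)"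

lemma mcoeff_msubst:
  "mcoeff (msubst Y f) \<gamma> = (\<Sum>\<beta> | size \<beta> \<le> size \<gamma>. mcoeff f \<beta> * mcoeff (mprod Y \<beta>) \<gamma>)"
  by (simp add: msubst_def)

text \<open>Coefficients of \<open>msubst\<close> are finite polynomial expressions, so the rule
  needs no condition on the constant terms of Y. This matters for the universal series used later,
  whose constant coefficients are variables that vanish only after specialisation.\<close>

lemma (in ring_morphism) map_mfps_msubst:
  "map_mfps h (msubst Y f) = msubst (\<lambda>\<nu>. map_mfps h (Y \<nu>)) (map_mfps h f)"
proof (rule mfps_eqI)
  fix \<gamma>
  have "h (mcoeff (mprod Y \<beta>) \<gamma>) = mcoeff (mprod (\<lambda>\<nu>. map_mfps h (Y \<nu>)) \<beta>) \<gamma>" for \<beta>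
    using ring_morphism.hom_mprod[OF map_mfps_morphism, of Y \<beta>] by (metis map_mfps.rep_eq)
  then show "mcoeff (map_mfps h (msubst Y f)) \<gamma> =
      mcoeff (msubst (\<lambda>\<nu>. map_mfps h (Y \<nu>)) (map_mfps h f)) \<gamma>"
    by (simp add: mcoeff_msubst hom_sum hom_mult)
qed

text \<open>Source and target may have different coefficient rings, as for the passage from K to the
  dual numbers and back. Only additivity is demanded, so uniqueness is tested on monomials with
  arbitrary constants.\<close>

definition filtered :: "(('v, 'a::comm_ring_1) mfps \<Rightarrow> ('w, 'b::comm_ring_1) mfps) \<Rightarrow> bool" where
  "filtered D \<longleftrightarrow> (\<forall>f g. D (f + g) = D f + D g) \<and> (\<forall>n. \<forall>f\<in>mord n. D f \<in> mord n)"

lemma filteredD: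
  assumes "filtered D"
  shows filtered_add: "D (f + g) = D f + D g"
    and filtered_mord: "f \<in> mord n \<Longrightarrow> D f \<in> mord n"
    and filtered_diff: "D (f - g) = D f - D g"
    and filtered_sum: "D (sum F A) = (\<Sum>x\<in>A. D (F x))"
proof -
  show add: "D (f + g) = D f + D g" for f g using assms by (simp add: filtered_def)
  show "f \<in> mord n \<Longrightarrow> D f \<in> mord n" using assms by (simp add: filtered_def)
  have zero: "D 0 = 0" using add[of 0 0] by simp
  show "D (f - g) = D f - D g" using add[of "f - g" g] by (simp add: algebra_simps)
  show "D (sum F A) = (\<Sum>x\<in>A. D (F x))"
    by (induction A rule: infinite_finite_induct) (auto simp: zero add)
qed

lemma filtered_id: "filtered (\<lambda>f. f)"
  and filtered_mult: "filtered D \<Longrightarrow> filtered (\<lambda>f. g * D f)"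
  and filtered_comp_mult: "filtered D \<Longrightarrow> filtered (\<lambda>f. D (g' * f))"
  and filtered_comp: "filtered D \<Longrightarrow> filtered D' \<Longrightarrow> filtered (\<lambda>f. D (D' f))"
  by (auto simp: filtered_def distrib_left mord_mult_left)

text \<open>Filtered maps are continuous for the \<open>\<mm>\<close>-adic topology.\<close>

lemma filtered_eqI:
  fixes D D' :: "('v::finite, 'a::comm_ring_1) mfps \<Rightarrow> ('w, 'b::comm_ring_1) mfps"
  assumes D: "filtered D" and D': "filtered D'"
    and eq: "\<And>c \<beta>. D (mconst c * mprod mvar \<beta>) = D' (mconst c * mprod mvar \<beta>)"
  shows "D f = D' f"
proof (rule mfps_eqI_mord)
  fix n
  define t where "t = (\<Sum>\<beta> | size \<beta> \<le> n. mconst (mcoeff f \<beta>) * mprod mvar \<beta>)"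
  have "mcoeff t \<gamma> = mcoeff f \<gamma>" if "size \<gamma> \<le> n" for \<gamma>
    using that by (simp add: t_def mcoeff_sum mcoeff_mprod_mvar if_distrib cong: if_cong)
  then have ft: "f - t \<in> mord n" by (intro mordI) simp
  have "D t = D' t"
    by (simp add: t_def filtered_sum[OF D] filtered_sum[OF D'] eq)
  then have "D f - D' f = D (f - t) - D' (f - t)"
    by (simp add: filtered_diff[OF D] filtered_diff[OF D'])
  then show "D f - D' f \<in> mord n"
    using filtered_mord[OF D ft] filtered_mord[OF D' ft] by (simp add: mord_diff)
qed

lemma filtered_msubst: "filtered (msubst Y)"
  unfolding filtered_def
proof (intro conjI allI ballI)
  show "msubst Y (f + g) = msubst Y f + msubst Y g" for f g
    by (rule mfps_eqI) (simp add: mcoeff_msubst distrib_right sum.distrib)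
  show "f \<in> mord n \<Longrightarrow> msubst Y f \<in> mord n" for n f
    by (rule mordI) (auto simp: mcoeff_msubst mordD intro!: sum.neutral)
qed

lemma msubst_mconst_mult: "msubst Y (mconst c * f) = mconst c * msubst Y f"
  by (rule mfps_eqI) (simp add: mcoeff_msubst sum_distrib_left mult.assoc)

text \<open>Here the cutoff in \<open>msubst\<close> is justified: the omitted coefficients of
  Y^\<beta> lie below its order and vanish.\<close>

lemma msubst_monomial:
  assumes "\<And>\<nu>. Y \<nu> \<in> mord 1"
  shows "msubst Y (mprod mvar \<beta>) = mprod Y \<beta>"
proof (rule mfps_eqI)
  fix \<gamma>
  have "mcoeff (msubst Y (mprod mvar \<beta>)) \<gamma> = (if size \<beta> \<le> size \<gamma> then mcoeff (mprod Y \<beta>) \<gamma> else 0)"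
    by (simp add: mcoeff_msubst mcoeff_mprod_mvar if_distrib[of "\<lambda>x. x * _"] cong: if_cong)
  then show "mcoeff (msubst Y (mprod mvar \<beta>)) \<gamma> = mcoeff (mprod Y \<beta>) \<gamma>"
    using mordD[OF mprod_in_mord[of Y, OF assms], of \<gamma> \<beta>] by auto
qed

lemma msubst_mvar: "(\<And>\<nu>. Y \<nu> \<in> mord 1) \<Longrightarrow> msubst Y (mvar \<nu>) = Y \<nu>"
  using msubst_monomial[of Y "{#\<nu>#}"] by simp

lemma msubst_1: "(\<And>\<nu>. Y \<nu> \<in> mord 1) \<Longrightarrow> msubst Y 1 = 1"
  using msubst_monomial[of Y "{#}"] by simp

text \<open>Both sides are filtered in each factor separately. Density of polynomials therefore
  reduces the claim first to one monomial factor and then to two.\<close>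

lemma msubst_mult:
  fixes Y :: "'v::finite \<Rightarrow> ('w, 'a::comm_ring_1) mfps"
  assumes "\<And>\<nu>. Y \<nu> \<in> mord 1"
  shows "msubst Y (f * g) = msubst Y f * msubst Y g"
proof -
  have mono: "msubst Y (mprod mvar \<beta> * g) = mprod Y \<beta> * msubst Y g" for \<beta> g
  proof (rule filtered_eqI[of "\<lambda>g. msubst Y (mprod mvar \<beta> * g)" "\<lambda>g. mprod Y \<beta> * msubst Y g"])
    fix c :: 'a and \<gamma>
    have "mprod mvar \<beta> * (mconst c * mprod mvar \<gamma>) = mconst c * mprod mvar (\<beta> + \<gamma>)"
      by (simp add: mprod_union mult.left_commute)
    then show "msubst Y (mprod mvar \<beta> * (mconst c * mprod mvar \<gamma>)) =
        mprod Y \<beta> * msubst Y (mconst c * mprod mvar \<gamma>)"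
      using msubst_monomial[of Y "\<beta> + \<gamma>", OF assms]
      by (simp add: msubst_mconst_mult msubst_monomial[OF assms] mprod_union mult.left_commute)
  qed (intro filtered_comp_mult filtered_mult filtered_msubst)+
  have "msubst Y (g * f) = msubst Y g * msubst Y f"
  proof (rule filtered_eqI[of "\<lambda>f. msubst Y (g * f)" "\<lambda>f. msubst Y g * msubst Y f"])
    fix c :: 'a and \<beta>
    have *: "g * (mconst c * mprod mvar \<beta>) = mconst c * (mprod mvar \<beta> * g)"
      by (simp add: ac_simps)
    show "msubst Y (g * (mconst c * mprod mvar \<beta>)) =
        msubst Y g * msubst Y (mconst c * mprod mvar \<beta>)"
      unfolding * by (simp only: msubst_mconst_mult msubst_monomial[OF assms] mono) (simp add: ac_simps)
  qed (intro filtered_comp_mult filtered_mult filtered_msubst)+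
  then show ?thesis by (simp add: mult.commute)
qed

lemma msubst_morphism: "(\<And>\<nu>. Y \<nu> \<in> mord 1) \<Longrightarrow> ring_morphism (msubst Y)"
  by unfold_locales (auto simp: filtered_add[OF filtered_msubst] msubst_mult msubst_1)

lemma msubst_id: "msubst mvar f = f"
  by (rule filtered_eqI[of "msubst mvar" "\<lambda>f. f"])
     (auto simp: filtered_msubst filtered_id msubst_mconst_mult msubst_monomial
       mvar_in_mord[unfolded One_nat_def])

lemma msubst_msubst:
  assumes "\<And>\<nu>. Y \<nu> \<in> mord 1" "\<And>\<nu>. Z \<nu> \<in> mord 1"
  shows "msubst Y (msubst Z f) = msubst (\<lambda>\<nu>. msubst Y (Z \<nu>)) f"
proof (rule filtered_eqI[of "\<lambda>f. msubst Y (msubst Z f)"])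
  show "filtered (\<lambda>f. msubst Y (msubst Z f))" "filtered (msubst (\<lambda>\<nu>. msubst Y (Z \<nu>)))"
    by (rule filtered_comp[OF filtered_msubst filtered_msubst], rule filtered_msubst)
  show "msubst Y (msubst Z (mconst c * mprod mvar \<beta>)) =
      msubst (\<lambda>\<nu>. msubst Y (Z \<nu>)) (mconst c * mprod mvar \<beta>)" for c \<beta>
    using msubst_monomial[of "\<lambda>\<nu>. msubst Y (Z \<nu>)", OF filtered_mord[OF filtered_msubst assms(2)]]
    by (simp only: msubst_mconst_mult msubst_monomial[OF assms(2)]
        ring_morphism.hom_mprod[OF msubst_morphism[OF assms(1)]])
qed

text \<open>This is why the k-jet of \<phi> f depends only on the k-jets of the series \<phi>
  x_\<nu>, so that the action descends to jets.\<close>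

lemma mord_msubst_cong:
  assumes "\<And>\<nu>. Y \<nu> - Z \<nu> \<in> mord n"
  shows "msubst Y f - msubst Z f \<in> mord n"
proof (rule mordI)
  fix \<gamma> :: "'b multiset" assume "size \<gamma> < n"
  then have "mcoeff (mprod Y \<beta> - mprod Z \<beta>) \<gamma> = 0" for \<beta>
    by (intro mordD[OF mord_mprod_cong[OF assms]])
  then show "mcoeff (msubst Y f - msubst Z f) \<gamma> = 0"
    by (simp add: mcoeff_msubst)
qed

section \<open>Automorphisms\<close>

lemma grp_R_D:
  assumes "\<phi> \<in> grp_R"
  shows grp_R_bij: "bij \<phi>" and grp_R_morphism: "ring_morphism \<phi>"
    and grp_R_mconst: "\<phi> (mconst c * f) = mconst c * \<phi> f"
  using assms by (auto simp: grp_R_def ring_morphism_def)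

lemma id_in_grp_R: "id \<in> grp_R"
  by (simp add: grp_R_def)

text \<open>A series with nonzero constant term is a unit. If \<phi> f were one, the preimage under
  \<phi> of its inverse would invert f, which has zero constant term.\<close>

lemma grp_R_max_ideal:
  assumes \<phi>: "\<phi> \<in> grp_R" and f: "f \<in> mord 1"
  shows "\<phi> f \<in> mord 1"
proof (rule ccontr)
  interpret ring_morphism \<phi> using \<phi> by (rule grp_R_morphism)
  assume "\<phi> f \<notin> mord 1"
  then have "mcoeff (\<phi> f) {#} \<noteq> 0" by (auto simp: mord_def)
  then obtain g where g: "\<phi> f * g = 1" by (rule mfps_unit)
  obtain g' where "\<phi> g' = g" using grp_R_bij[OF \<phi>] by (metis bij_pointE)
  then have "\<phi> (f * g') = \<phi> 1" using g by (simp add: hom_mult hom_one)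
  then have "f * g' = 1" using grp_R_bij[OF \<phi>] by (metis bij_is_inj injD)
  then have "mcoeff f {#} * mcoeff g' {#} = 1" by (metis mcoeff_mult_empty one_mfps.rep_eq)
  then show False using f by (simp add: mordD)
qed

lemma grp_R_mord:
  fixes \<phi> :: "('v::finite, 'k::field) endo"
  assumes \<phi>: "\<phi> \<in> grp_R"
  shows "f \<in> mord n \<Longrightarrow> \<phi> f \<in> mord n"
proof (induction n arbitrary: f)
  case (Suc n)
  interpret ring_morphism \<phi> using \<phi> by (rule grp_R_morphism)
  obtain g where g: "\<And>\<nu>. g \<nu> \<in> mord n" and f: "f = (\<Sum>\<nu>\<in>UNIV. mvar \<nu> * g \<nu>)"
    using mord_Suc_decomp Suc.prems by blast
  show ?case unfolding f hom_sum hom_mult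
    using mord_mult[OF grp_R_max_ideal[OF \<phi> mvar_in_mord] Suc.IH[OF g]] by (intro mord_sum) simp
qed simp

text \<open>Automatic continuity: by \<open>grp_R_mord\<close> the automorphism is filtered, and it
  agrees with the substitution on monomials because it is a K-algebra map.\<close>

lemma grp_R_eq_msubst:
  fixes \<phi> :: "('v::finite, 'k::field) endo"
  assumes \<phi>: "\<phi> \<in> grp_R"
  shows "\<phi> f = msubst (\<lambda>\<nu>. \<phi> (mvar \<nu>)) f"
proof (rule filtered_eqI[of \<phi>])
  interpret ring_morphism \<phi> using \<phi> by (rule grp_R_morphism)
  show "filtered \<phi>" using grp_R_mord[OF \<phi>] by (simp add: filtered_def hom_add)
  show "filtered (msubst (\<lambda>\<nu>. \<phi> (mvar \<nu>)))" by (rule filtered_msubst)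
  show "\<phi> (mconst c * mprod mvar \<beta>) = msubst (\<lambda>\<nu>. \<phi> (mvar \<nu>)) (mconst c * mprod mvar \<beta>)" for c \<beta>
    by (simp only: grp_R_mconst[OF \<phi>] msubst_mconst_mult hom_mprod
        msubst_monomial[OF grp_R_max_ideal[OF \<phi> mvar_in_mord]])
qed

lemma msubst_in_grp_R:
  assumes "\<And>\<nu>. Y \<nu> \<in> mord 1" "bij (msubst Y)"
  shows "msubst Y \<in> grp_R"
  using assms
  by (simp add: grp_R_def msubst_1 msubst_mult msubst_mconst_mult filtered_add[OF filtered_msubst])

section \<open>Elementary automorphisms\<close>

definition elem_subst :: "'v \<Rightarrow> 'v multiset \<Rightarrow> 'k::field \<Rightarrow> 'v \<Rightarrow> ('v, 'k) mfps" where
  "elem_subst \<nu> \<alpha> t = mvar(\<nu> := mvar \<nu> + mconst t * mprod mvar \<alpha>)"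

lemma mprod_mvar_mord_1: "\<alpha> \<noteq> {#} \<Longrightarrow> mprod mvar \<alpha> \<in> mord 1"
  using mord_antimono[OF mprod_mvar_in_mord[of \<alpha>], of 1] by (simp add: Suc_leI nonempty_has_size)

lemma elem_subst_mord: "\<alpha> \<noteq> {#} \<Longrightarrow> elem_subst \<nu> \<alpha> t \<mu> \<in> mord 1"
  unfolding elem_subst_def fun_upd_def
  by (auto intro!: mord_add mord_mult_left simp del: One_nat_def simp: mvar_in_mord mprod_mvar_mord_1)

text \<open>Such a substitution changes a monomial only in degrees above its own. Hence it is the
  identity plus a map that raises the order, and \<open>id_plus_bij\<close> applies.\<close>

lemma bij_msubst_higher_order:
  fixes Y :: "'v::finite \<Rightarrow> ('v, 'a::comm_ring_1) mfps"
  assumes Y: "\<And>\<nu>. Y \<nu> - mvar \<nu> \<in> mord 2"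
  shows "bij (msubst Y)"
proof -
  have Y1: "Y \<nu> \<in> mord 1" for \<nu>
    using mord_add[OF mord_antimono[OF Y[of \<nu>], of 1] mvar_in_mord[of \<nu>]] by simp
  have lead: "mprod Y \<beta> - mprod mvar \<beta> \<in> mord (Suc (size \<beta>))" for \<beta>
  proof (induction \<beta>)
    case (add \<nu> \<beta>)
    have "mprod Y (add_mset \<nu> \<beta>) - mprod mvar (add_mset \<nu> \<beta>) =
        Y \<nu> * (mprod Y \<beta> - mprod mvar \<beta>) + (Y \<nu> - mvar \<nu>) * mprod mvar \<beta>"
      by (simp add: algebra_simps)
    moreover have "Y \<nu> * (mprod Y \<beta> - mprod mvar \<beta>) \<in> mord (Suc (size (add_mset \<nu> \<beta>)))"
      using mord_mult[OF Y1[of \<nu>] add] by simp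
    moreover have "(Y \<nu> - mvar \<nu>) * mprod mvar \<beta> \<in> mord (Suc (size (add_mset \<nu> \<beta>)))"
      using mord_mult[OF Y[of \<nu>] mprod_mvar_in_mord[of \<beta>]] by simp
    ultimately show ?case by (simp only: mord_add)
  qed auto
  have "bij (\<lambda>f. f + (msubst Y f - f))"
  proof (rule id_plus_bij)
    show "msubst Y (f - g) - (f - g) = msubst Y f - f - (msubst Y g - g)" for f g
      by (simp add: filtered_diff[OF filtered_msubst])
    fix n and f :: "('v, 'a) mfps" assume f: "f \<in> mord n"
    show "msubst Y f - f \<in> mord (Suc n)"
    proof (rule mordI)
      fix \<gamma> :: "'v multiset" assume \<gamma>: "size \<gamma> < Suc n"
      \<comment> \<open>The order of f is at least n and \<gamma> has degree at most n. A term that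
        is not killed by f has \<open>size \<beta> = size \<gamma> = n\<close>, and in this degree
        Y^\<beta> and x^\<beta> have the same coefficients.\<close>
      have "mcoeff f \<beta> * mcoeff (mprod Y \<beta>) \<gamma> = (if \<beta> = \<gamma> then mcoeff f \<gamma> else 0)"
        if "size \<beta> \<le> size \<gamma>" for \<beta>
      proof (cases "size \<beta> < n")
        case True
        then show ?thesis using f by (auto simp: mordD)
      next
        case False
        then have "size \<gamma> < Suc (size \<beta>)" using \<gamma> by simp
        from mordD[OF lead this] show ?thesis by (auto simp: mcoeff_mprod_mvar)
      qed
      then have "mcoeff (msubst Y f) \<gamma> = (\<Sum>\<beta> | size \<beta> \<le> size \<gamma>. if \<beta> = \<gamma> then mcoeff f \<gamma> else 0)"
        unfolding mcoeff_msubst by (intro sum.cong) auto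
      then show "mcoeff (msubst Y f - f) \<gamma> = 0" by simp
    qed
  qed
  then show ?thesis by simp
qed

text \<open>If \<alpha> has degree at least 2, the substitution is the identity up to higher order.
  In degree 1 it is linear: either scaling of x_\<nu> by 1 + t, whence t \<noteq> -1, or a
  shear.\<close>

lemma elem_subst_in_grp_R:
  fixes t :: "'k::field" and \<nu> :: "'v::finite"
  assumes \<alpha>: "\<alpha> \<noteq> {#}" and t: "t \<noteq> - 1"
  shows "msubst (elem_subst \<nu> \<alpha> t) \<in> grp_R"
proof (rule msubst_in_grp_R)
  let ?Y = "elem_subst \<nu> \<alpha> t"
  show Y: "?Y \<mu> \<in> mord 1" for \<mu> using \<alpha> by (rule elem_subst_mord)
  show "bij (msubst ?Y)"
  proof (cases "2 \<le> size \<alpha>")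
    case True
    then have "mprod mvar \<alpha> \<in> (mord 2 :: ('v, 'k) mfps set)"
      using mord_antimono[OF mprod_mvar_in_mord] by blast
    then show ?thesis
      by (intro bij_msubst_higher_order) (auto simp: elem_subst_def mord_mult_left)
  next
    case False
    then have "size \<alpha> = 1" using \<alpha> nonempty_has_size[of \<alpha>] by linarith
    then obtain \<mu> where \<mu>: "\<alpha> = {#\<mu>#}" by (metis One_nat_def size_1_singleton_mset)
    \<comment> \<open>The inverse linear substitution: scaling by 1/(1 + t), or the shear with
      -t.\<close>
    define Z where "Z = mvar(\<nu> := if \<mu> = \<nu> then mconst (1 / (1 + t)) * mvar \<nu>
      else mvar \<nu> + mconst (- t) * mvar \<mu>)"
    have Z: "Z \<rho> \<in> mord 1" for \<rho>
      unfolding Z_def fun_upd_def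
      by (auto intro!: mord_add mord_mult_left simp del: One_nat_def simp: mvar_in_mord)
    have t': "1 + t \<noteq> 0" using t by (metis add.commute eq_neg_iff_add_eq_0)
    have c: "mvar \<nu> + mconst t * mvar \<nu> = mconst (1 + t) * (mvar \<nu> :: ('v, 'k) mfps)"
      by (simp add: mconst_add distrib_right)
    have cc: "mconst a * (mconst b * f) = mconst (a * b) * (f :: ('v, 'k) mfps)" for a b f
      by (simp add: mconst_mult mult.assoc)
    have neg: "mconst (- t) = - (mconst t :: ('v, 'k) mfps)"
      by (auto intro!: mfps_eqI)
    have Y_eq: "?Y \<rho> = (if \<rho> \<noteq> \<nu> then mvar \<rho> else if \<mu> = \<nu> then mconst (1 + t) * mvar \<nu>
        else mvar \<nu> + mconst t * mvar \<mu>)" for \<rho>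
      by (simp add: elem_subst_def \<mu> c)
    have Z_eq: "Z \<rho> = (if \<rho> \<noteq> \<nu> then mvar \<rho> else if \<mu> = \<nu> then mconst (1 / (1 + t)) * mvar \<nu>
        else mvar \<nu> + mconst (- t) * mvar \<mu>)" for \<rho>
      by (simp add: Z_def)
    have "msubst ?Y (Z \<rho>) = mvar \<rho>" for \<rho>
      unfolding Z_eq[of \<rho>] using t'
      by (auto simp: filtered_add[OF filtered_msubst] filtered_diff[OF filtered_msubst]
          msubst_mconst_mult msubst_mvar[OF Y] Y_eq cc neg)
    moreover have "msubst Z (?Y \<rho>) = mvar \<rho>" for \<rho>
      unfolding Y_eq[of \<rho>] using t'
      by (auto simp: filtered_add[OF filtered_msubst] filtered_diff[OF filtered_msubst]
          msubst_mconst_mult msubst_mvar[OF Z] Z_eq cc neg)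
    ultimately have "msubst ?Y \<circ> msubst Z = id" "msubst Z \<circ> msubst ?Y = id"
      by (auto simp: fun_eq_iff msubst_msubst[OF Y Z] msubst_msubst[OF Z Y] msubst_id)
    then show ?thesis using o_bij by blast
  qed
qed

section \<open>Polynomials and tangent spaces\<close>

lemma (in ring_morphism) poly_val_superset:
  assumes "finite A" "Poly_Mapping.keys F \<subseteq> A"
  shows "poly_val h p F = (\<Sum>\<alpha>\<in>A. h (Poly_Mapping.lookup F \<alpha>) * mprod p \<alpha>)"
  unfolding poly_val_def mprod_def
  by (rule sum.mono_neutral_left[OF assms]) (simp add: hom_zero in_keys_iff)

lemma (in ring_morphism) poly_val_single: "poly_val h p (Poly_Mapping.single \<alpha> c) = h c * mprod p \<alpha>"
  by (subst poly_val_superset[of "{\<alpha>}"]) auto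

lemma (in ring_morphism) poly_val_add: "poly_val h p (F + G) = poly_val h p F + poly_val h p G"
proof -
  let ?A = "Poly_Mapping.keys F \<union> Poly_Mapping.keys G"
  show ?thesis
    using poly_val_superset[of ?A F p] poly_val_superset[of ?A G p]
      poly_val_superset[of ?A "F + G" p, OF _ keys_add]
    by (simp add: lookup_add hom_add distrib_right sum.distrib)
qed

lemma (in ring_morphism) poly_val_morphism: "ring_morphism (poly_val h p)"
proof
  fix F G
  show "poly_val h p (F + G) = poly_val h p F + poly_val h p G" by (rule poly_val_add)
  have zero: "poly_val h p 0 = 0" by (simp add: poly_val_def)
  have sum: "poly_val h p (sum f A) = (\<Sum>x\<in>A. poly_val h p (f x))" for f :: "'z \<Rightarrow> _" and A
    by (induction A rule: infinite_finite_induct) (auto simp: poly_val_add zero)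
  have monomials: "F = (\<Sum>\<alpha>\<in>Poly_Mapping.keys F. Poly_Mapping.single \<alpha> (Poly_Mapping.lookup F \<alpha>))" for F
    by (rule poly_mapping_eqI) (simp add: lookup_sum lookup_single when_def in_keys_iff)
  have "poly_val h p (F * G) = (\<Sum>\<alpha>\<in>Poly_Mapping.keys F. \<Sum>\<beta>\<in>Poly_Mapping.keys G.
      h (Poly_Mapping.lookup F \<alpha> * Poly_Mapping.lookup G \<beta>) * mprod p (\<alpha> + \<beta>))"
    by (subst monomials[of F], subst monomials[of G])
       (simp add: sum_product mult_single sum poly_val_single)
  also have "\<dots> = poly_val h p F * poly_val h p G"
    by (simp add: poly_val_def mprod_def sum_product hom_mult ac_simps)
  finally show "poly_val h p (F * G) = poly_val h p F * poly_val h p G" .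
  show "poly_val h p 1 = 1"
    using poly_val_single[of p 0 1] by (simp add: hom_one)
qed

lemma (in ring_morphism) hom_poly_val:
  "h (poly_val g p F) = poly_val (\<lambda>c. h (g c)) (\<lambda>i. h (p i)) F"
  by (simp add: poly_val_def hom_sum hom_mult hom_mprod flip: mprod_def)

definition PVar :: "'i \<Rightarrow> 'i multiset \<Rightarrow>\<^sub>0 'k::comm_ring_1" where
  "PVar i = Poly_Mapping.single {#i#} 1"

definition PConst :: "'k::comm_ring_1 \<Rightarrow> 'i multiset \<Rightarrow>\<^sub>0 'k" where
  "PConst c = Poly_Mapping.single {#} c"

lemma (in ring_morphism) poly_val_PVar: "poly_val h p (PVar i) = p i"
  and poly_val_PConst: "poly_val h p (PConst c) = h c"
  by (simp_all add: PVar_def PConst_def poly_val_single hom_one)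

lemma to_ac_morphism: "ring_morphism to_ac"
  by unfold_locales auto

lemma const_poly_morphism: "ring_morphism (\<lambda>c. [:c:])"
  by unfold_locales (auto simp: one_pCons)

lemma dual_val_morphism: "ring_morphism (dual_val p v)"
  using ring_morphism.poly_val_morphism[OF const_poly_morphism]
  by (simp add: dual_val_def[abs_def])

lemma poly_to_ac_morphism: "ring_morphism (\<lambda>q. poly (map_poly to_ac q) t)"
proof -
  have "map_poly to_ac (p + q) = map_poly to_ac p + map_poly to_ac q"
    "map_poly to_ac (p * q) = map_poly to_ac p * map_poly to_ac q" for p q :: "'a poly"
    by (auto intro!: poly_eqI simp: coeff_map_poly coeff_mult to_ac_sum)
  then show ?thesis by unfold_locales auto
qed

text \<open>Before reduction modulo t^2, \<open>dual_val p v F\<close> is the restriction of F to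
  the line p + t v. One object thus carries both the tangent condition and the values on the
  line.\<close>

lemma poly_dual_val:
  "poly (map_poly to_ac (dual_val p v F)) t = poly_val to_ac (\<lambda>i. to_ac (p i) + t * to_ac (v i)) F"
  by (simp add: dual_val_def ring_morphism.hom_poly_val[OF poly_to_ac_morphism] map_poly_pCons)

lemma monom_2_dvd_iff: "Polynomial.monom 1 2 dvd q \<longleftrightarrow> Polynomial.coeff q 0 = 0 \<and> Polynomial.coeff q 1 = 0"
  by (auto simp: monom_1_dvd_iff' less_2_cases_iff)

text \<open>As in Euclid's argument: if the field were finite, one plus the product of all X - a
  would be nonconstant without a root.\<close>

lemma infinite_UNIV_alg_closed: "infinite (UNIV :: 'a::alg_closed_field set)"
proof
  assume fin: "finite (UNIV :: 'a set)"
  define q where "q = (\<Prod>a\<in>(UNIV :: 'a set). [:- a, 1:]) + 1"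
  have deg: "degree (\<Prod>a\<in>(UNIV :: 'a set). [:- a, 1:]) = card (UNIV :: 'a set)"
    by (subst degree_prod_eq_sum_degree) auto
  moreover have "card (UNIV :: 'a set) > 0"
    using fin by (simp add: card_gt_0_iff)
  ultimately have "degree q > 0"
    unfolding q_def by (subst degree_add_eq_left) auto
  then obtain x where "poly q x = 0" using alg_closed_imp_poly_has_root by blast
  moreover have "poly q x = 1"
    using fin by (simp add: q_def poly_prod)
  ultimately show False by simp
qed

lemma coeff_0_morphism: "ring_morphism (\<lambda>q :: 'k::field poly. Polynomial.coeff q 0)"
  by unfold_locales (auto simp: coeff_mult_0)

lemma coeff_0_dual_val: "Polynomial.coeff (dual_val p v F) 0 = poly_val (\<lambda>c. c) p F"
  by (simp add: dual_val_def ring_morphism.hom_poly_val[OF coeff_0_morphism])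

lemma coeff_1_mult:
  "Polynomial.coeff (p * q) 1 =
     Polynomial.coeff p 0 * Polynomial.coeff q 1 + Polynomial.coeff p 1 * Polynomial.coeff q 0"
  by (simp add: coeff_mult)

text \<open>The \<epsilon>-part is the differential of F at p. On monomials its linearity in the
  direction follows from the Leibniz rule \<open>coeff_1_mult\<close>, because the \<epsilon>-free
  parts do not involve the direction.\<close>

lemma coeff_1_dual_val_linear:
  "Polynomial.coeff (dual_val p (\<lambda>i. a * v i + w i) F) 1 =
     a * Polynomial.coeff (dual_val p v F) 1 + Polynomial.coeff (dual_val p w F) 1"
proof -
  have c0: "Polynomial.coeff (mprod (\<lambda>i. [:p i, v i:]) \<alpha>) 0 = mprod p \<alpha>" for v \<alpha>
    by (induction \<alpha>) (auto simp: coeff_mult_0)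
  have "Polynomial.coeff (mprod (\<lambda>i. [:p i, a * v i + w i:]) \<alpha>) 1 =
      a * Polynomial.coeff (mprod (\<lambda>i. [:p i, v i:]) \<alpha>) 1
        + Polynomial.coeff (mprod (\<lambda>i. [:p i, w i:]) \<alpha>) 1" for \<alpha>
    by (induction \<alpha>) (simp_all only: mprod_empty mprod_add_mset coeff_1_mult c0,
        simp_all add: algebra_simps)
  then show ?thesis
    by (simp add: dual_val_def poly_val_def coeff_sum sum_distrib_left sum.distrib distrib_left
        mult.left_commute flip: mprod_def)
qed

section \<open>Tangent spaces and tangent maps\<close>

lemma tangent_spaceD:
  assumes "v \<in> tangent_space S p" "\<And>x. x \<in> S \<Longrightarrow> poly_val to_ac x F = 0"
  shows "Polynomial.coeff (dual_val p v F) 0 = 0" "Polynomial.coeff (dual_val p v F) 1 = 0"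
  using assms by (auto simp: tangent_space_def monom_2_dvd_iff)

lemma tangent_space_linear:
  assumes "v \<in> tangent_space S p" "w \<in> tangent_space S p"
  shows "(\<lambda>i. a * v i + w i) \<in> tangent_space S p"
  unfolding tangent_space_def monom_2_dvd_iff
proof (intro CollectI allI impI)
  fix F assume F: "\<forall>x\<in>S. poly_val to_ac x F = 0"
  show "Polynomial.coeff (dual_val p (\<lambda>i. a * v i + w i) F) 0 = 0 \<and>
      Polynomial.coeff (dual_val p (\<lambda>i. a * v i + w i) F) 1 = 0"
    using tangent_spaceD[OF assms(1), of F] tangent_spaceD[OF assms(2), of F] F
    by (simp only: coeff_1_dual_val_linear coeff_0_dual_val) simp
qed

text \<open>A polynomial over \<open>K\<close> vanishing at infinitely many points of a line vanishes on the line.\<close>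

lemma tangent_space_lineI:
  assumes "infinite {t. (\<lambda>i. to_ac (p i) + t * to_ac (v i)) \<in> S}"
  shows "v \<in> tangent_space S p"
  unfolding tangent_space_def
proof (intro CollectI allI impI)
  fix F assume F: "\<forall>x\<in>S. poly_val to_ac x F = 0"
  let ?q = "map_poly to_ac (dual_val p v F)"
  have "{t. (\<lambda>i. to_ac (p i) + t * to_ac (v i)) \<in> S} \<subseteq> {t. poly ?q t = 0}"
    using F by (auto simp: poly_dual_val)
  then have "infinite {t. poly ?q t = 0}" using assms finite_subset by blast
  then have "?q = 0" using poly_roots_finite by blast
  then have "Polynomial.coeff (dual_val p v F) i = 0" for i
    by (metis coeff_map_poly coeff_0 to_ac_0 to_ac_eq_0_iff)
  then show "Polynomial.monom 1 2 dvd dual_val p v F" by (simp add: monom_2_dvd_iff)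
qed

lemma tangent_space_eqI:
  assumes I: "finite I" and pS: "(\<lambda>i. to_ac (p i)) \<in> S"
    and out: "\<And>x i. x \<in> S \<Longrightarrow> i \<notin> I \<Longrightarrow> x i = 0"
    and line: "\<And>i t. i \<in> I \<Longrightarrow> t \<noteq> - 1 \<Longrightarrow> (\<lambda>j. to_ac (p j) + (if j = i then t else 0)) \<in> S"
  shows "tangent_space S p = {v. \<forall>i. i \<notin> I \<longrightarrow> v i = 0}"
proof (intro equalityI subsetI)
  fix v assume v: "v \<in> tangent_space S p"
  have "v i = 0" if "i \<notin> I" for i
  proof -
    \<comment> \<open>Outside I the coordinate function itself is an equation of S, and its
      \<epsilon>-part at v is \<open>v i\<close>.\<close>
    have "poly_val to_ac x (PVar i) = 0" if "x \<in> S" for x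
      using out[OF that \<open>i \<notin> I\<close>] by (simp add: ring_morphism.poly_val_PVar[OF to_ac_morphism])
    from tangent_spaceD(2)[OF v this] show ?thesis
      by (simp add: dual_val_def ring_morphism.poly_val_PVar[OF const_poly_morphism])
  qed
  then show "v \<in> {v. \<forall>i. i \<notin> I \<longrightarrow> v i = 0}" by blast
next
  fix v :: "_ \<Rightarrow> 'b" assume v: "v \<in> {v. \<forall>i. i \<notin> I \<longrightarrow> v i = 0}"
  \<comment> \<open>For the zero direction the line is constant at p, so every t qualifies and it
    suffices that p lies in S.\<close>
  have zero: "(\<lambda>_. 0) \<in> tangent_space S p"
    by (rule tangent_space_lineI) (use pS infinite_UNIV_alg_closed in simp)
  have unit: "(\<lambda>j. if j = i then 1 else 0) \<in> tangent_space S p" if "i \<in> I" for i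
  proof (rule tangent_space_lineI)
    have "(\<lambda>j. to_ac (p j) + t * to_ac (if j = i then 1 else 0)) =
        (\<lambda>j. to_ac (p j) + (if j = i then t else 0))" for t
      by auto
    then have "- {- 1} \<subseteq> {t. (\<lambda>j. to_ac (p j) + t * to_ac (if j = i then 1 else 0)) \<in> S}"
      using line[OF that] by auto
    moreover have "infinite (- {- 1 :: 'b alg_closure})"
      using infinite_UNIV_alg_closed[where 'a = "'b alg_closure"] by (simp add: Compl_eq_Diff_UNIV)
    ultimately show "infinite {t. (\<lambda>j. to_ac (p j) + t * to_ac (if j = i then 1 else 0)) \<in> S}"
      using finite_subset by blast
  qed
  have "(\<lambda>j. if j \<in> J then v j else 0) \<in> tangent_space S p" if "finite J" "J \<subseteq> I" for J
    using that
  proof (induction J rule: finite_induct)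
    case (insert i J)
    have "(\<lambda>j. v i * (if j = i then 1 else 0) + (if j \<in> J then v j else 0)) \<in> tangent_space S p"
      using insert by (intro tangent_space_linear unit) auto
    moreover have "(\<lambda>j. v i * (if j = i then 1 else 0) + (if j \<in> J then v j else 0)) =
        (\<lambda>j. if j \<in> insert i J then v j else 0)"
      using insert by auto
    ultimately show ?case by simp
  qed (simp add: zero)
  from this[OF I] have "(\<lambda>j. if j \<in> I then v j else 0) \<in> tangent_space S p" by simp
  moreover have "(\<lambda>j. if j \<in> I then v j else 0) = v" using v by auto
  ultimately show "v \<in> tangent_space S p" by simp
qed

text \<open>Two polynomial descriptions of f differ by an equation of S, whose \<epsilon>-part
  vanishes on tangent vectors; hence the description in \<open>tangent_map\<close> is
  unique.\<close>

lemma tangent_map_eq: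
  assumes P: "\<And>x j. x \<in> S \<Longrightarrow> f x j = poly_val to_ac x (P j)"
    and v: "v \<in> tangent_space S p"
  shows "tangent_map S f p v = (\<lambda>j. Polynomial.coeff (dual_val p v (P j)) 1)"
  unfolding tangent_map_def
proof (rule the_equality)
  show "\<exists>P'. (\<forall>x\<in>S. \<forall>j. f x j = poly_val to_ac x (P' j)) \<and>
      (\<forall>j. Polynomial.coeff (dual_val p v (P j)) 1 = Polynomial.coeff (dual_val p v (P' j)) 1)"
    using P by blast
  fix w assume "\<exists>P'. (\<forall>x\<in>S. \<forall>j. f x j = poly_val to_ac x (P' j)) \<and>
      (\<forall>j. w j = Polynomial.coeff (dual_val p v (P' j)) 1)"
  then obtain P' where P': "\<And>x j. x \<in> S \<Longrightarrow> f x j = poly_val to_ac x (P' j)"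
    and w: "\<And>j. w j = Polynomial.coeff (dual_val p v (P' j)) 1" by blast
  have "Polynomial.coeff (dual_val p v (P' j)) 1 = Polynomial.coeff (dual_val p v (P j)) 1" for j
  proof -
    define D where "D = P' j - P j"
    then have D: "P' j = D + P j" by simp
    have "poly_val to_ac x D = 0" if "x \<in> S" for x
      using P[OF that, of j] P'[OF that, of j]
      by (simp add: D ring_morphism.poly_val_add[OF to_ac_morphism])
    from tangent_spaceD(2)[OF v this] show ?thesis
      by (simp add: D ring_morphism.hom_add[OF dual_val_morphism])
  qed
  then show "w = (\<lambda>j. Polynomial.coeff (dual_val p v (P j)) 1)" by (simp add: w fun_eq_iff)
qed

lemma dvd_mprod_diff:
  fixes x y :: "'i \<Rightarrow> 'r::comm_ring_1"
  assumes "\<And>i. d dvd x i - y i"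
  shows "d dvd mprod x \<alpha> - mprod y \<alpha>"
proof (induction \<alpha>)
  case (add i \<alpha>)
  have "mprod x (add_mset i \<alpha>) - mprod y (add_mset i \<alpha>) =
      x i * (mprod x \<alpha> - mprod y \<alpha>) + mprod y \<alpha> * (x i - y i)"
    by (simp add: algebra_simps)
  then show ?case using assms[of i] add by simp
qed auto

lemma dvd_poly_val_diff:
  fixes x y :: "'i \<Rightarrow> 'r::comm_ring_1"
  assumes "\<And>i. d dvd x i - y i"
  shows "d dvd poly_val h x F - poly_val h y F"
  unfolding poly_val_def sum_subtractf[symmetric] right_diff_distrib[symmetric]
  by (intro dvd_sum dvd_mult dvd_mprod_diff[OF assms, unfolded mprod_def])

text \<open>The chain rule over the dual numbers: equations of the image are pulled back along P to
  equations of S, which the tangent vector satisfies.\<close>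

lemma tangent_map_in_tangent_space:
  assumes P: "\<And>x j. x \<in> S \<Longrightarrow> f x j = poly_val to_ac x (P j)"
    and v: "v \<in> tangent_space S p"
    and q: "\<And>j. Polynomial.coeff (dual_val p v (P j)) 0 = q j"
  shows "tangent_map S f p v \<in> tangent_space (f ` S) q"
  unfolding tangent_space_def
proof (intro CollectI allI impI)
  let ?w = "\<lambda>j. Polynomial.coeff (dual_val p v (P j)) 1"
  have w: "tangent_map S f p v = ?w" using P v by (rule tangent_map_eq)
  fix F assume F: "\<forall>y\<in>f ` S. poly_val to_ac y F = 0"
  \<comment> \<open>The composite of F with P, as a polynomial in the coordinates of S.\<close>
  define H where "H = poly_val PConst P F"
  have "poly_val to_ac x H = 0" if "x \<in> S" for x
  proof -
    interpret ring_morphism to_ac by (rule to_ac_morphism)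
    have "poly_val to_ac x H = poly_val to_ac (\<lambda>j. poly_val to_ac x (P j)) F"
      by (simp add: H_def ring_morphism.hom_poly_val[OF poly_val_morphism] poly_val_PConst)
    also have "(\<lambda>j. poly_val to_ac x (P j)) = f x" using P[OF that] by auto
    finally show ?thesis using F that by simp
  qed
  then have H: "Polynomial.monom 1 2 dvd dual_val p v H"
    using v by (simp add: tangent_space_def)
  have "dual_val p v H = poly_val (\<lambda>c. [:c:]) (\<lambda>j. dual_val p v (P j)) F"
    unfolding H_def ring_morphism.hom_poly_val[OF dual_val_morphism]
    by (simp add: dual_val_def ring_morphism.poly_val_PConst[OF const_poly_morphism])
  \<comment> \<open>The polynomial \<open>dual_val p v (P j)\<close> may have terms beyond degree 1;
    it equals the point q + t w only modulo t^2, and F preserves this congruence.\<close>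
  moreover have "Polynomial.monom 1 2 dvd
      dual_val q ?w F - poly_val (\<lambda>c. [:c:]) (\<lambda>j. dual_val p v (P j)) F"
    unfolding dual_val_def[of q]
    by (rule dvd_poly_val_diff) (simp add: monom_2_dvd_iff q)
  ultimately show "Polynomial.monom 1 2 dvd dual_val q (tangent_map S f p v) F"
    unfolding w using H by (metis diff_add_cancel dvd_add)
qed

section \<open>Jets of matrices\<close>

lemma mat_coords_eq_iff:
  fixes A B :: "('v, 'a::comm_ring_1) mfps ^ 'n ^ 'm"
  shows "mat_coords k A = mat_coords k B \<longleftrightarrow> (\<forall>i j. A $ i $ j - B $ i $ j \<in> mord (Suc k))"
  by (force simp: mat_coords_def fun_eq_iff mord_def less_Suc_eq_le)

lemma mat_coords_hom:
  "h 0 = 0 \<Longrightarrow> h (mat_coords k A j) = mat_coords k (map_matrix (map_mfps h) A) j"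
  by (simp add: mat_coords_def map_matrix_def split: prod.split)

lemma mat_coords_add_cong:
  assumes "mat_coords k A = mat_coords k A'" "mat_coords k B = mat_coords k B'"
  shows "mat_coords k (A + B) = mat_coords k (A' + B')"
proof -
  have "(A + B) $ i $ j - (A' + B') $ i $ j = (A $ i $ j - A' $ i $ j) + (B $ i $ j - B' $ i $ j)" for i j
    by simp
  then show ?thesis using assms by (simp only: mat_coords_eq_iff mord_add simp_thms)
qed

lemma mat_coords_mult_cong:
  assumes "mat_coords k A = mat_coords k A'" "mat_coords k B = mat_coords k B'"
  shows "mat_coords k (A ** B) = mat_coords k (A' ** B')"
proof -
  have "(A ** B) $ i $ j - (A' ** B') $ i $ j =
      (\<Sum>l\<in>UNIV. A $ i $ l * (B $ l $ j - B' $ l $ j) + B' $ l $ j * (A $ i $ l - A' $ i $ l))" for i j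
    unfolding matrix_matrix_mult_def vec_lambda_beta sum_subtractf[symmetric]
    by (rule sum.cong) (simp_all add: algebra_simps)
  then show ?thesis
    using assms by (simp add: mat_coords_eq_iff mord_sum mord_add mord_mult_left)
qed

lemma jet_kernel_iff:
  fixes A :: "('v::finite, 'k::field) mfps ^ 'n ^ 'm"
  shows "A \<in> jet_kernel k \<longleftrightarrow> (\<forall>i j. A $ i $ j \<in> mord (Suc k))"
proof
  let ?N = "{A :: ('v, 'k) mfps ^ 'n ^ 'm. \<forall>i j. A $ i $ j \<in> mord (Suc k)}"
  have "matrix_module.subspace ?N"
    by (auto simp: matrix_module.subspace_def mscale_def mord_add mord_mult_left)
  then have "jet_kernel k \<subseteq> ?N"
    unfolding jet_kernel_def ideal_smult_def ideal_power_max_ideal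
    by (intro matrix_module.span_minimal) (auto simp: mscale_def mord_mult_right)
  then show "A \<in> jet_kernel k \<Longrightarrow> \<forall>i j. A $ i $ j \<in> mord (Suc k)" by blast
  assume A: "\<forall>i j. A $ i $ j \<in> mord (Suc k)"
  \<comment> \<open>Expanding A in these unit matrices exhibits it as a sum of multiples with
    factors in \<mm>^(k+1).\<close>
  define E :: "'m \<Rightarrow> 'n \<Rightarrow> ('v, 'k) mfps ^ 'n ^ 'm" where
    "E p q = (\<chi> i j. if j = q then (if i = p then 1 else 0) else 0)" for p q
  have "A = (\<Sum>p\<in>UNIV. \<Sum>q\<in>UNIV. mscale (A $ p $ q) (E p q))"
    by (simp add: vec_eq_iff mscale_def E_def if_distrib[of "\<lambda>x. _ * x"] cong: if_cong)
  also have "\<dots> \<in> jet_kernel k"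
    unfolding jet_kernel_def ideal_smult_def ideal_power_max_ideal
    using A by (intro matrix_module.span_sum matrix_module.span_base) auto
  finally show "A \<in> jet_kernel k" .
qed

lemma jet_eq_iff:
  fixes A B :: "('v::finite, 'k::field) mfps ^ 'n ^ 'm"
  shows "jet k A = jet k B \<longleftrightarrow> mat_coords k A = mat_coords k B"
proof -
  have mem: "B \<in> jet k A \<longleftrightarrow> mat_coords k B = mat_coords k A" for A B :: "('v, 'k) mfps ^ 'n ^ 'm"
    by (simp add: jet_def jet_kernel_iff mat_coords_eq_iff)
  then show ?thesis by (auto simp: set_eq_iff)
qed

text \<open>Tangent vectors carry only coefficients up to degree k, so an element of N is matched by
  some f v only modulo \<mm>^(k+1). This suffices after passing to jets.\<close>

lemma jet_image_eq:
  fixes N :: "(('v::finite, 'k::field) mfps ^ 'n ^ 'm) set"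
  assumes "\<And>v. v \<in> T \<Longrightarrow> f v \<in> N"
    and "\<And>B. B \<in> N \<Longrightarrow> \<exists>v\<in>T. mat_coords k (f v) = mat_coords k B"
  shows "jet k ` f ` T = jet k ` (N + jet_kernel k)"
proof (intro equalityI subsetI)
  fix J assume "J \<in> jet k ` f ` T"
  then obtain v where v: "v \<in> T" and J: "J = jet k (f v)" by auto
  have "f v + 0 \<in> N + jet_kernel k"
    using assms(1)[OF v] by (intro set_plus_intro) (simp_all add: jet_kernel_iff)
  then show "J \<in> jet k ` (N + jet_kernel k)" by (simp add: J)
next
  fix J assume "J \<in> jet k ` (N + jet_kernel k)"
  then obtain B C where B: "B \<in> N" and C: "C \<in> jet_kernel k" and J: "J = jet k (B + C)"
    by (auto elim!: set_plus_elim)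
  obtain v where v: "v \<in> T" and "mat_coords k (f v) = mat_coords k B" using assms(2)[OF B] by blast
  moreover have "mat_coords k (B + C) = mat_coords k B"
    using C by (simp add: mat_coords_eq_iff jet_kernel_iff)
  ultimately have "J = jet k (f v)" by (simp add: J jet_eq_iff)
  then show "J \<in> jet k ` f ` T" using v by blast
qed

section \<open>First order expansion of the action\<close>

lemma map_mfps_map_mfps: "map_mfps f (map_mfps g x) = map_mfps (\<lambda>c. f (g c)) x"
  by (rule mfps_eqI) simp

lemma map_matrix_map_matrix: "map_matrix f (map_matrix g A) = map_matrix (\<lambda>x. f (g x)) A"
  by (simp add: map_matrix_def vec_eq_iff)

text \<open>The case of the Leibniz rule that drives the induction over monomials in
  \<open>order1_msubst\<close>.\<close>

lemma mderiv_mvar_mult: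
  fixes f :: "('v, 'b::comm_ring_1) mfps"
  shows "mderiv \<nu> (mvar \<mu> * f) = (if \<mu> = \<nu> then f else 0) + mvar \<mu> * mderiv \<nu> f"
proof (rule mfps_eqI)
  fix \<gamma>
  show "mcoeff (mderiv \<nu> (mvar \<mu> * f)) \<gamma> =
      mcoeff ((if \<mu> = \<nu> then f else 0) + mvar \<mu> * mderiv \<nu> f) \<gamma>"
  proof (cases "\<mu> \<in># \<gamma>")
    case True
    then obtain \<delta> where "\<gamma> = add_mset \<mu> \<delta>" by (metis insert_DiffM)
    then show ?thesis
      by (auto simp: mcoeff_mvar_mult distrib_right add_mset_commute)
  next
    case False
    then have "count \<gamma> \<mu> = 0" by (simp add: count_eq_zero_iff)
    then have "(of_nat (count \<gamma> \<mu>) :: 'b) = 0" by (simp only: of_nat_0)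
    with False show ?thesis
      by (auto simp: mcoeff_mvar_mult)
  qed
qed

lemma mderiv_mconst_mult: "mderiv \<nu> (mconst c * f) = mconst c * mderiv \<nu> f"
  and mderiv_1: "mderiv \<nu> 1 = 0"
  by (rule mfps_eqI; simp add: mult.left_commute)+

text \<open>Differentiation lowers the order by at most one, and the factor from \<mm> restores
  it.\<close>

lemma filtered_mult_mderiv:
  fixes w :: "'v::finite \<Rightarrow> ('v, 'a::comm_ring_1) mfps"
  assumes "\<And>\<nu>. w \<nu> \<in> mord 1"
  shows "filtered (\<lambda>f. \<Sum>\<nu>\<in>UNIV. w \<nu> * mderiv \<nu> f)"
  unfolding filtered_def
proof (intro conjI allI ballI)
  have "mderiv \<nu> (f + g) = mderiv \<nu> f + mderiv \<nu> g" for \<nu> and f g :: "('v, 'a) mfps"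
    by (rule mfps_eqI) (simp add: distrib_left)
  then show "(\<Sum>\<nu>\<in>UNIV. w \<nu> * mderiv \<nu> (f + g)) =
      (\<Sum>\<nu>\<in>UNIV. w \<nu> * mderiv \<nu> f) + (\<Sum>\<nu>\<in>UNIV. w \<nu> * mderiv \<nu> g)" for f g
    by (simp add: distrib_left sum.distrib)
  fix n and f :: "('v, 'a) mfps" assume f: "f \<in> mord n"
  have "w \<nu> * mderiv \<nu> f \<in> mord n" for \<nu>
  proof -
    \<comment> \<open>For n = 0 the truncated difference is 0, which is still correct.\<close>
    have "mderiv \<nu> f \<in> mord (n - 1)" by (rule mordI) (simp add: mordD[OF f])
    from mord_mult[OF assms this, of \<nu>] show ?thesis by (rule mord_antimono) simp
  qed
  then show "(\<Sum>\<nu>\<in>UNIV. w \<nu> * mderiv \<nu> f) \<in> mord n" by (intro mord_sum)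
qed

section \<open>Reduction modulo \<epsilon> and the \<epsilon>-part, coefficientwise\<close>

abbreviation order0 :: "('v, 'k::field poly) mfps \<Rightarrow> ('v, 'k) mfps" where
  "order0 \<equiv> map_mfps (\<lambda>q. Polynomial.coeff q 0)"

abbreviation order1 :: "('v, 'k::field poly) mfps \<Rightarrow> ('v, 'k) mfps" where
  "order1 \<equiv> map_mfps (\<lambda>q. Polynomial.coeff q 1)"

lemma order1_mult: "order1 (f * g) = order0 f * order1 g + order1 f * order0 g"
  by (rule mfps_eqI)
     (simp add: mcoeff_mult coeff_sum coeff_1_mult sum.distrib case_prod_unfold del: One_nat_def)

lemma order1_sum: "order1 (sum f S) = (\<Sum>x\<in>S. order1 (f x))"
  by (rule mfps_eqI) (simp add: mcoeff_sum coeff_sum)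

lemma order1_matrix_mult:
  "map_matrix order1 (A ** B) =
     map_matrix order0 A ** map_matrix order1 B + map_matrix order1 A ** map_matrix order0 B"
  by (simp add: map_matrix_def matrix_matrix_mult_def vec_eq_iff order1_sum order1_mult sum.distrib
      del: One_nat_def)

lemma order0_msubst:
  fixes f :: "('v::finite, 'k::field) mfps"
  assumes "\<And>\<nu>. order0 (Y \<nu>) = mvar \<nu>"
  shows "order0 (msubst Y (map_mfps (\<lambda>c. [:c:]) f)) = f"
proof -
  have "map_mfps (\<lambda>c. c) f = f" by (rule mfps_eqI) simp
  then show ?thesis
    by (simp add: ring_morphism.map_mfps_msubst[OF coeff_0_morphism] map_mfps_map_mfps assms msubst_id)
qed

text \<open>Taylor expansion to first order. Both sides are filtered, so monomials with constants
  suffice, and there the formula follows by the Leibniz rule, one variable at a time.\<close>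

lemma order1_msubst:
  fixes f :: "('v::finite, 'k::field) mfps"
  assumes Y: "\<And>\<nu>. Y \<nu> \<in> mord 1" and Y0: "\<And>\<nu>. order0 (Y \<nu>) = mvar \<nu>"
  shows "order1 (msubst Y (map_mfps (\<lambda>c. [:c:]) f)) = (\<Sum>\<nu>\<in>UNIV. order1 (Y \<nu>) * mderiv \<nu> f)"
proof (rule filtered_eqI[of "\<lambda>f. order1 (msubst Y (map_mfps (\<lambda>c. [:c:]) f))"])
  have const: "map_mfps (\<lambda>c. [:c:]) (f + g) = map_mfps (\<lambda>c. [:c:]) f + map_mfps (\<lambda>c. [:c:]) g"
    "map_mfps (\<lambda>c. [:c:]) (mconst c * mprod mvar \<beta>) = mconst [:c:] * mprod mvar \<beta>"
    for f g :: "('v, 'k) mfps" and c \<beta>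
    by (rule mfps_eqI; simp add: mcoeff_mprod_mvar one_pCons)+
  have "filtered (map_mfps (\<lambda>c. [:c:]) :: ('v, 'k) mfps \<Rightarrow> _)"
    "filtered (order1 :: ('v, 'k poly) mfps \<Rightarrow> _)"
    by (auto simp: filtered_def const mord_def intro!: mfps_eqI)
  then show "filtered (\<lambda>f. order1 (msubst Y (map_mfps (\<lambda>c. [:c:]) f)))"
    using filtered_comp[OF _ filtered_comp[OF filtered_msubst]] by blast
  have "order1 (Y \<nu>) \<in> mord 1" for \<nu>
    using Y[of \<nu>] by (simp add: mord_def)
  then show "filtered (\<lambda>f. \<Sum>\<nu>\<in>UNIV. order1 (Y \<nu>) * mderiv \<nu> f)" by (rule filtered_mult_mderiv)
  fix c \<beta>
  have mono0: "order0 (mprod Y \<beta>) = mprod mvar \<beta>" for \<beta>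
    using ring_morphism.hom_mprod[OF ring_morphism.map_mfps_morphism[OF coeff_0_morphism], of Y \<beta>]
    by (simp add: Y0)
  have mono1: "order1 (mprod Y \<beta>) = (\<Sum>\<nu>\<in>UNIV. order1 (Y \<nu>) * mderiv \<nu> (mprod mvar \<beta>))"
  proof (induction \<beta>)
    case empty
    show ?case by (auto simp: mderiv_1 intro!: mfps_eqI)
  next
    case (add \<mu> \<beta>)
    have "(\<Sum>\<nu>\<in>UNIV. order1 (Y \<nu>) * mderiv \<nu> (mprod mvar (add_mset \<mu> \<beta>))) =
        order1 (Y \<mu>) * mprod mvar \<beta>
          + mvar \<mu> * (\<Sum>\<nu>\<in>UNIV. order1 (Y \<nu>) * mderiv \<nu> (mprod mvar \<beta>))"
      by (simp add: mderiv_mvar_mult distrib_left sum.distrib sum_distrib_left mult.left_commute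
          if_distrib[of "\<lambda>x. _ * x"] cong: if_cong)
    then show ?case by (simp only: mprod_add_mset order1_mult Y0 mono0 add) simp
  qed
  have "order1 (mconst [:c:] * g) = mconst c * order1 g" for g :: "('v, 'k poly) mfps"
    by (rule mfps_eqI) simp
  then show "order1 (msubst Y (map_mfps (\<lambda>c. [:c:]) (mconst c * mprod mvar \<beta>))) =
      (\<Sum>\<nu>\<in>UNIV. order1 (Y \<nu>) * mderiv \<nu> (mconst c * mprod mvar \<beta>))"
    by (simp only: const msubst_mconst_mult msubst_monomial[OF Y] mono1 mderiv_mconst_mult)
       (simp add: sum_distrib_left mult.left_commute)
qed

definition tangent_vec ::
  "('v::finite, 'k::field) mfps ^ 'n ^ 'm \<Rightarrow> ('v, 'k) mfps ^ 'm ^ 'm \<Rightarrow> ('v, 'k) mfps ^ 'n ^ 'n \<Rightarrow>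
   ('v \<Rightarrow> ('v, 'k) mfps) \<Rightarrow> ('v, 'k) mfps ^ 'n ^ 'm" where
  "tangent_vec A U V w = U ** A + A ** V + (\<Sum>\<nu>\<in>UNIV. mscale (w \<nu>) (map_matrix (mderiv \<nu>) A))"

text \<open>The three factors reduce to I, A and I modulo \<epsilon>, so the Leibniz rule leaves one
  summand for each.\<close>

lemma action_first_order:
  fixes A :: "('v::finite, 'k::field) mfps ^ 'n ^ 'm"
  assumes Y: "\<And>\<nu>. Y \<nu> \<in> mord 1" and Y0: "\<And>\<nu>. order0 (Y \<nu>) = mvar \<nu>"
    and U: "map_matrix order0 U = mat 1" and V: "map_matrix order0 V = mat 1"
  defines "M \<equiv> U ** map_matrix (\<lambda>f. msubst Y (map_mfps (\<lambda>c. [:c:]) f)) A ** V"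
  shows "map_matrix order0 M = A"
    and "map_matrix order1 M =
      tangent_vec A (map_matrix order1 U) (map_matrix order1 V) (\<lambda>\<nu>. order1 (Y \<nu>))"
proof -
  let ?A = "map_matrix (\<lambda>f. msubst Y (map_mfps (\<lambda>c. [:c:]) f)) A"
  note mult0 = ring_morphism.map_matrix_mult[OF ring_morphism.map_mfps_morphism[OF coeff_0_morphism]]
  have A0: "map_matrix order0 ?A = A"
    unfolding map_matrix_map_matrix order0_msubst[OF Y0] by (simp add: map_matrix_def)
  have A1: "map_matrix order1 ?A = (\<Sum>\<nu>\<in>UNIV. mscale (order1 (Y \<nu>)) (map_matrix (mderiv \<nu>) A))"
    unfolding map_matrix_map_matrix order1_msubst[OF Y Y0]
    by (simp add: map_matrix_def mscale_def vec_eq_iff)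
  show "map_matrix order0 M = A"
    by (simp add: M_def mult0 A0 U V)
  show "map_matrix order1 M =
      tangent_vec A (map_matrix order1 U) (map_matrix order1 V) (\<lambda>\<nu>. order1 (Y \<nu>))"
    unfolding M_def order1_matrix_mult mult0 A0 A1 U V by (simp add: tangent_vec_def algebra_simps)
qed

lemma mat_coords_tangent_vec_cong:
  fixes A :: "('v::finite, 'k::field) mfps ^ 'n ^ 'm"
  assumes "mat_coords k U = mat_coords k U'" "mat_coords k V = mat_coords k V'"
    and "\<And>\<nu>. w \<nu> - w' \<nu> \<in> mord (Suc k)"
  shows "mat_coords k (tangent_vec A U V w) = mat_coords k (tangent_vec A U' V' w')"
proof -
  have "(\<Sum>\<nu>\<in>UNIV. mscale (w \<nu>) (B \<nu>)) $ i $ j - (\<Sum>\<nu>\<in>UNIV. mscale (w' \<nu>) (B \<nu>)) $ i $ j =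
      (\<Sum>\<nu>\<in>UNIV. B \<nu> $ i $ j * (w \<nu> - w' \<nu>))"
    for B :: "'v \<Rightarrow> ('v, 'k) mfps ^ 'n ^ 'm" and i j
    unfolding sum_component mscale_def vec_lambda_beta sum_subtractf[symmetric]
    by (rule sum.cong) (simp_all add: algebra_simps)
  then have "mat_coords k (\<Sum>\<nu>\<in>UNIV. mscale (w \<nu>) (B \<nu>)) = mat_coords k (\<Sum>\<nu>\<in>UNIV. mscale (w' \<nu>) (B \<nu>))"
    for B :: "'v \<Rightarrow> ('v, 'k) mfps ^ 'n ^ 'm"
    using assms(3) by (simp add: mat_coords_eq_iff mord_sum mord_mult_left del: sum_component)
  then show ?thesis
    unfolding tangent_vec_def using assms(1,2)
    by (intro mat_coords_add_cong mat_coords_mult_cong) auto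
qed

section \<open>The orbit map in coordinates\<close>

text \<open>
  \<open>U\<close>, \<open>V\<close>, \<open>Y\<close> describe the universal group element, with polynomials in the coordinates as
  coefficients. Specialising them by \<open>poly_val\<close> gives the orbit map, by \<open>dual_val\<close> its tangent map.
\<close>

lemma tangent_image_generic:
  fixes A :: "('v::finite, 'k::field) mfps ^ 'n ^ 'm"
    and crd :: "'g \<Rightarrow> 'i \<Rightarrow> 'k alg_closure"
    and act :: "'g \<Rightarrow> ('v, 'k alg_closure) mfps ^ 'n ^ 'm \<Rightarrow> ('v, 'k alg_closure) mfps ^ 'n ^ 'm"
    and U :: "('v, 'i multiset \<Rightarrow>\<^sub>0 'k) mfps ^ 'm ^ 'm" and V :: "('v, 'i multiset \<Rightarrow>\<^sub>0 'k) mfps ^ 'n ^ 'n"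
    and Y :: "'v \<Rightarrow> ('v, 'i multiset \<Rightarrow>\<^sub>0 'k) mfps"
  defines "spec \<equiv> \<lambda>x. map_mfps (poly_val to_ac x)"
  assumes act: "\<And>g. g \<in> G \<Longrightarrow> \<exists>U' V' \<phi>. \<phi> \<in> grp_R \<and> act g = (\<lambda>B. U' ** map_matrix \<phi> B ** V') \<and>
      mat_coords k (map_matrix (spec (crd g)) U) = mat_coords k U' \<and>
      mat_coords k (map_matrix (spec (crd g)) V) = mat_coords k V' \<and>
      (\<forall>\<nu>. spec (crd g) (Y \<nu>) - \<phi> (mvar \<nu>) \<in> mord (Suc k))"
    and U0: "\<And>v. v \<in> tangent_space (crd ` G) e \<Longrightarrow>
      map_matrix (\<lambda>f. order0 (map_mfps (dual_val e v) f)) U = mat 1"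
    and V0: "\<And>v. v \<in> tangent_space (crd ` G) e \<Longrightarrow>
      map_matrix (\<lambda>f. order0 (map_mfps (dual_val e v) f)) V = mat 1"
    and Y0: "\<And>v \<nu>. v \<in> tangent_space (crd ` G) e \<Longrightarrow> order0 (map_mfps (dual_val e v) (Y \<nu>)) = mvar \<nu>"
    and Y: "\<And>v \<nu>. v \<in> tangent_space (crd ` G) e \<Longrightarrow> map_mfps (dual_val e v) (Y \<nu>) \<in> mord 1"
  shows "orbit_tangent_map_welldef G crd e act k A \<and>
    tangent_image G crd e act k A = jet k `
      (\<lambda>v. tangent_vec A (map_matrix (\<lambda>f. order1 (map_mfps (dual_val e v) f)) U)
          (map_matrix (\<lambda>f. order1 (map_mfps (dual_val e v) f)) V)
          (\<lambda>\<nu>. order1 (map_mfps (dual_val e v) (Y \<nu>)))) ` tangent_space (crd ` G) e"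
    (is "_ \<and> _ = jet k ` ?\<Delta> ` ?T")
proof -
  \<comment> \<open>The translate of A by the universal group element. Its coefficients are the
    polynomials that represent the orbit map.\<close>
  define M where "M = U ** map_matrix (\<lambda>f. msubst Y (map_mfps PConst f)) A ** V"
  have spec_M: "map_matrix (map_mfps h) M = map_matrix (map_mfps h) U **
      map_matrix (\<lambda>f. msubst (\<lambda>\<nu>. map_mfps h (Y \<nu>)) (map_mfps (\<lambda>c. h (PConst c)) f)) A **
      map_matrix (map_mfps h) V"
    if "ring_morphism h" for h :: "('i multiset \<Rightarrow>\<^sub>0 'k) \<Rightarrow> 'r::comm_ring_1"
    by (simp add: M_def ring_morphism.map_matrix_mult[OF ring_morphism.map_mfps_morphism[OF that]]
        map_matrix_map_matrix ring_morphism.map_mfps_msubst[OF that] map_mfps_map_mfps)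
  \<comment> \<open>The coordinates of g fix its matrices and the series \<phi> x_\<nu> only modulo
    \<mm>^(k+1). Products and substitution respect this congruence, so the jet of the translate is
    still determined.\<close>
  have orbit: "mat_coords k (act g (base_change A)) = (\<lambda>j. poly_val to_ac (crd g) (mat_coords k M j))"
    if g: "g \<in> G" for g
  proof -
    obtain U' V' \<phi> where \<phi>: "\<phi> \<in> grp_R" and actg: "act g = (\<lambda>B. U' ** map_matrix \<phi> B ** V')"
      and U': "mat_coords k (map_matrix (spec (crd g)) U) = mat_coords k U'"
      and V': "mat_coords k (map_matrix (spec (crd g)) V) = mat_coords k V'"
      and Y': "\<And>\<nu>. spec (crd g) (Y \<nu>) - \<phi> (mvar \<nu>) \<in> mord (Suc k)"
      using act[OF g] by blast
    have hom: "ring_morphism (poly_val to_ac (crd g))"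
      by (rule ring_morphism.poly_val_morphism[OF to_ac_morphism])
    have "msubst (\<lambda>\<nu>. spec (crd g) (Y \<nu>)) f - \<phi> f \<in> mord (Suc k)" for f
      unfolding grp_R_eq_msubst[OF \<phi>, of f] by (rule mord_msubst_cong[OF Y'])
    then have "mat_coords k (map_matrix (\<lambda>f. msubst (\<lambda>\<nu>. spec (crd g) (Y \<nu>)) (map_mfps to_ac f)) A) =
        mat_coords k (map_matrix \<phi> (base_change A))"
      by (simp add: mat_coords_eq_iff base_change_def map_matrix_def)
    then have "mat_coords k (act g (base_change A)) = mat_coords k (map_matrix (spec (crd g)) M)"
      unfolding actg spec_def spec_M[OF hom] ring_morphism.poly_val_PConst[OF to_ac_morphism]
      using U' V' by (intro mat_coords_mult_cong) (simp_all add: spec_def)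
    then show ?thesis
      by (simp add: fun_eq_iff mat_coords_hom ring_morphism.hom_zero[OF hom] spec_def)
  qed
  \<comment> \<open>\<open>orbit\<close> expresses the jet through \<open>crd g\<close> alone, so
    the description is unique although several g share the same coordinates.\<close>
  have orbit_map: "orbit_map G crd act k A (crd g) = mat_coords k (act g (base_change A))"
    if "g \<in> G" for g
    unfolding orbit_map_def using that orbit by (intro the_equality) auto
  then have P: "orbit_map G crd act k A x j = poly_val to_ac x (mat_coords k M j)"
    if "x \<in> crd ` G" for x j
    using that orbit by auto
  have orbit_eq: "jet_orbit G act k A = orbit_map G crd act k A ` crd ` G"
    using orbit_map by (force simp: jet_orbit_def)
  have M_order: "map_matrix (\<lambda>f. order0 (map_mfps (dual_val e v) f)) M = A"
    "map_matrix (\<lambda>f. order1 (map_mfps (dual_val e v) f)) M = ?\<Delta> v" if v: "v \<in> ?T" for v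
  proof -
    have const: "dual_val e v (PConst c) = [:c:]" for c
      by (simp add: dual_val_def ring_morphism.poly_val_PConst[OF const_poly_morphism])
    have U0': "map_matrix order0 (map_matrix (map_mfps (dual_val e v)) U) = mat 1"
      and V0': "map_matrix order0 (map_matrix (map_mfps (dual_val e v)) V) = mat 1"
      using U0[OF v] V0[OF v] by (simp_all add: map_matrix_map_matrix)
    note first = action_first_order[OF Y[OF v] Y0[OF v] U0' V0', of A]
    note Mv = spec_M[OF dual_val_morphism, of e v, unfolded const]
    show "map_matrix (\<lambda>f. order0 (map_mfps (dual_val e v) f)) M = A"
      using first(1)[folded Mv] by (simp only: map_matrix_map_matrix)
    show "map_matrix (\<lambda>f. order1 (map_mfps (dual_val e v) f)) M = ?\<Delta> v"
      using first(2)[folded Mv] by (simp only: map_matrix_map_matrix)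
  qed
  \<comment> \<open>The case n = 0 gives the base point, n = 1 the tangent map.\<close>
  have coeff_M: "Polynomial.coeff (dual_val e v (mat_coords k M j)) n =
      mat_coords k (map_matrix (\<lambda>f. map_mfps (\<lambda>q. Polynomial.coeff q n) (map_mfps (dual_val e v) f)) M) j"
    for v j n
    using mat_coords_hom[of "\<lambda>F. Polynomial.coeff (dual_val e v F) n" k M j]
    by (simp add: map_mfps_map_mfps ring_morphism.hom_zero[OF dual_val_morphism])
  have "orbit_tangent_map_welldef G crd e act k A"
    unfolding orbit_tangent_map_welldef_def orbit_tangent_map_def orbit_eq
  proof
    fix v assume v: "v \<in> ?T"
    show "tangent_map (crd ` G) (orbit_map G crd act k A) e v
        \<in> tangent_space (orbit_map G crd act k A ` crd ` G) (mat_coords k A)"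
    proof (rule tangent_map_in_tangent_space[OF _ v])
      show "Polynomial.coeff (dual_val e v (mat_coords k M j)) 0 = mat_coords k A j" for j
        unfolding coeff_M M_order[OF v] ..
    qed (rule P)
  qed
  moreover have "orbit_tangent_map G crd e act k A v = mat_coords k (?\<Delta> v)" if v: "v \<in> ?T" for v
  proof -
    have "orbit_tangent_map G crd e act k A v =
        (\<lambda>j. Polynomial.coeff (dual_val e v (mat_coords k M j)) 1)"
      unfolding orbit_tangent_map_def using P v by (rule tangent_map_eq)
    then show ?thesis unfolding coeff_M M_order[OF v] .
  qed
  then have "orbit_tangent_map G crd e act k A ` ?T = mat_coords k ` ?\<Delta> ` ?T"
    by (simp add: image_image)
  then have "tangent_image G crd e act k A = jet k ` ?\<Delta> ` ?T"
    unfolding tangent_image_def by (auto simp: jet_eq_iff[symmetric])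
  ultimately show ?thesis ..
qed

section \<open>Coordinates on the groups\<close>

definition series_coords :: "nat \<Rightarrow> ('v \<Rightarrow> ('v, 'a::zero) mfps) \<Rightarrow> 'v \<times> 'v multiset \<Rightarrow> 'a" where
  "series_coords k w = (\<lambda>(\<nu>, \<alpha>). if size \<alpha> \<le> k then mcoeff (w \<nu>) \<alpha> else 0)"

lemma aut_coords_eq: "aut_coords k \<phi> = series_coords k (\<lambda>\<nu>. \<phi> (mvar \<nu>))"
  by (simp add: aut_coords_def series_coords_def)

text \<open>Picks the representative of degree at most k of a jet, over any coefficients. Applied to
  the variables \<open>PVar\<close> it yields a universal matrix.\<close>

definition mat_of_coords ::
  "nat \<Rightarrow> ('m \<times> 'n \<times> 'v multiset \<Rightarrow> 'a::zero) \<Rightarrow> ('v, 'a) mfps ^ 'n ^ 'm" where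
  "mat_of_coords k v = (\<chi> i j. Abs_mfps (\<lambda>\<alpha>. if size \<alpha> \<le> k then v (i, j, \<alpha>) else 0))"

definition series_of_coords ::
  "nat \<Rightarrow> ('v \<times> 'v multiset \<Rightarrow> 'a::zero) \<Rightarrow> 'v \<Rightarrow> ('v, 'a) mfps" where
  "series_of_coords k v \<nu> = Abs_mfps (\<lambda>\<alpha>. if size \<alpha> \<le> k then v (\<nu>, \<alpha>) else 0)"

lemma map_mat_of_coords:
  "h 0 = 0 \<Longrightarrow> map_matrix (map_mfps h) (mat_of_coords k v) = mat_of_coords k (\<lambda>i. h (v i))"
  by (auto simp: map_matrix_def mat_of_coords_def vec_eq_iff intro!: mfps_eqI)

lemma map_series_of_coords:
  "h 0 = 0 \<Longrightarrow> map_mfps h (series_of_coords k v \<nu>) = series_of_coords k (\<lambda>i. h (v i)) \<nu>"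
  by (auto simp: series_of_coords_def intro!: mfps_eqI)

lemma mat_coords_mat_of_coords:
  "mat_coords k (mat_of_coords k (mat_coords k A)) = mat_coords k A"
  by (auto simp: mat_coords_def mat_of_coords_def fun_eq_iff)

lemma mat_of_coords_1: "mat_of_coords k (mat_coords k (mat 1)) = mat 1"
  by (auto simp: mat_coords_def mat_of_coords_def vec_eq_iff mat_def intro!: mfps_eqI)

lemma series_of_coords_series_coords: "series_of_coords k (series_coords k w) \<nu> - w \<nu> \<in> mord (Suc k)"
  by (rule mordI) (simp add: series_of_coords_def series_coords_def)

text \<open>Here k \<ge> 1 enters: the coefficient 1 of x_\<nu> sits in degree one and must survive
  the truncation.\<close>

lemma series_of_coords_mvar: "1 \<le> k \<Longrightarrow> series_of_coords k (series_coords k mvar) \<nu> = mvar \<nu>"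
  by (rule mfps_eqI) (auto simp: series_of_coords_def series_coords_def mvar.rep_eq)

definition mat_index :: "nat \<Rightarrow> ('m \<times> 'n \<times> 'v multiset) set" where
  "mat_index k = {(i, j, \<alpha>). size \<alpha> \<le> k}"

text \<open>Automorphisms preserve the maximal ideal, hence the omitted constant coefficients.\<close>

definition aut_index :: "nat \<Rightarrow> ('v \<times> 'v multiset) set" where
  "aut_index k = {(\<nu>, \<alpha>). \<alpha> \<noteq> {#} \<and> size \<alpha> \<le> k}"

lemma finite_mat_index: "finite (mat_index k :: ('m::finite \<times> 'n::finite \<times> 'v::finite multiset) set)"
proof -
  have "mat_index k = (UNIV :: 'm set) \<times> (UNIV :: 'n set) \<times> {\<alpha> :: 'v multiset. size \<alpha> \<le> k}"
    by (auto simp: mat_index_def)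
  then show ?thesis by simp
qed

lemma finite_aut_index: "finite (aut_index k :: ('v::finite \<times> 'v multiset) set)"
  by (rule finite_subset[of _ "UNIV \<times> {\<alpha>. size \<alpha> \<le> k}"]) (auto simp: aut_index_def)

lemma mat_coords_outside: "i \<notin> mat_index k \<Longrightarrow> mat_coords k A i = 0"
  by (auto simp: mat_index_def mat_coords_def split: prod.splits)

lemma series_coords_outside:
  "(\<And>\<nu>. w \<nu> \<in> mord 1) \<Longrightarrow> i \<notin> aut_index k \<Longrightarrow> series_coords k w i = 0"
  by (auto simp: aut_index_def series_coords_def mordD[of _ "Suc 0"] split: prod.splits)

lemma mat_coords_support: "mat_coords k A i \<noteq> 0 \<Longrightarrow> i \<in> mat_index k"
  using mat_coords_outside by blast

lemma series_coords_support:
  "series_coords k w i \<noteq> 0 \<Longrightarrow> (\<And>\<nu>. w \<nu> \<in> mord 1) \<Longrightarrow> i \<in> aut_index k"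
  using series_coords_outside by blast

lemma aut_coords_outside: "\<phi> \<in> grp_R \<Longrightarrow> i \<notin> aut_index k \<Longrightarrow> aut_coords k \<phi> i = 0"
  unfolding aut_coords_eq by (rule series_coords_outside[OF grp_R_max_ideal[OF _ mvar_in_mord]])

lemma series_of_coords_mord_1:
  "(\<And>i. i \<notin> aut_index k \<Longrightarrow> v i = 0) \<Longrightarrow> series_of_coords k v \<nu> \<in> mord 1"
  by (rule mordI) (simp add: series_of_coords_def aut_index_def)

lemma to_ac_mat_coords_1:
  "to_ac (mat_coords k (mat 1 :: ('v, 'k::field) mfps ^ 'n ^ 'n) i) = mat_coords k (mat 1) i"
  by (auto simp: mat_coords_def mat_def split: prod.splits)

lemma to_ac_aut_coords_id:
  "to_ac (aut_coords k (id :: ('v, 'k::field) endo) i) = aut_coords k id i"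
  by (auto simp: aut_coords_def mvar.rep_eq split: prod.splits)

lemma matrix_add_rdistrib: "(A + B) ** C = A ** C + B ** (C :: 'a::semiring_1 ^ 'n ^ 'm)"
  by (simp add: matrix_matrix_mult_def vec_eq_iff distrib_right sum.distrib)

text \<open>The matrix is I + a E_pq with a = t x^\<alpha>. Off the diagonal its inverse is I - a
  E_pq. On the diagonal 1 + a must be a unit; its constant term is 1 + t if \<alpha> is empty and 1
  otherwise.\<close>

lemma elementary_matrix:
  fixes t :: "'k::field" and i :: "'n::finite \<times> 'n \<times> 'v multiset"
  assumes t: "t \<noteq> - 1" and i: "i \<in> mat_index k"
  obtains U :: "('v, 'k) mfps ^ 'n ^ 'n"
  where "invertible U" "mat_coords k U = (\<lambda>j. mat_coords k (mat 1) j + (if j = i then t else 0))"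
proof -
  obtain p q \<alpha> where ipq: "i = (p, q, \<alpha>)" by (cases i)
  define E :: "('v, 'k) mfps \<Rightarrow> ('v, 'k) mfps ^ 'n ^ 'n" where
    "E a = (\<chi> i j. if j = q then if i = p then a else 0 else 0)" for a
  have E_add: "E a + E b = E (a + b)" for a b
    by (simp add: E_def vec_eq_iff)
  have E_mult: "E a ** E b = (if p = q then E (a * b) else 0)" for a b
    by (auto simp: E_def vec_eq_iff matrix_matrix_mult_def if_distrib[of "\<lambda>x. x * _"] cong: if_cong)
  \<comment> \<open>Invertibility becomes a scalar equation: (1 + a)(1 + b) = 1 on the diagonal, a +
    b = 0 off it.\<close>
  have E_prod: "(mat 1 + E a) ** (mat 1 + E b) = mat 1 + (if p = q then E (a + b + a * b) else E (a + b))"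
    for a b
    by (simp add: matrix_add_ldistrib matrix_add_rdistrib E_mult E_add[symmetric] ac_simps)
  have E_0: "E 0 = 0" by (simp add: E_def vec_eq_iff)
  define a where "a = mconst t * mprod mvar \<alpha>"
  have "\<exists>b. (if p = q then a + b + a * b else a + b) = 0"
  proof (cases "p = q")
    case True
    have "mcoeff (1 + a) {#} \<noteq> 0"
      using t by (auto simp: a_def mcoeff_mprod_mvar add_eq_0_iff eq_commute[of "- 1"] minus_equation_iff)
    then obtain g where "(1 + a) * g = 1" by (rule mfps_unit)
    \<comment> \<open>With g inverse to 1 + a, the solution is b = g - 1.\<close>
    then have "a + (g - 1) + a * (g - 1) = 0" by (simp add: algebra_simps)
    then show ?thesis using True by auto
  next
    case False
    then show ?thesis by (auto intro: exI[of _ "- a"])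
  qed
  then obtain b where b: "(if p = q then a + b + a * b else a + b) = 0" ..
  moreover from this have "(if p = q then b + a + b * a else b + a) = 0"
    by (simp add: ac_simps split: if_splits)
  ultimately have "(mat 1 + E a) ** (mat 1 + E b) = mat 1" "(mat 1 + E b) ** (mat 1 + E a) = mat 1"
    by (auto simp: E_prod E_0 split: if_splits)
  then have "invertible (mat 1 + E a)" by (auto simp: invertible_def)
  moreover have "mat_coords k (mat 1 + E a) = (\<lambda>j. mat_coords k (mat 1) j + (if j = i then t else 0))"
    using i by (auto simp: mat_coords_def fun_eq_iff E_def a_def ipq mat_index_def mcoeff_mprod_mvar)
  ultimately show ?thesis by (rule that)
qed

lemma elementary_automorphism:
  fixes t :: "'k::field" and i :: "'v::finite \<times> 'v multiset"
  assumes t: "t \<noteq> - 1" and i: "i \<in> aut_index k"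
  obtains \<phi> :: "('v, 'k) endo"
  where "\<phi> \<in> grp_R" "aut_coords k \<phi> = (\<lambda>j. aut_coords k id j + (if j = i then t else 0))"
proof -
  obtain \<nu> \<alpha> where i_eq: "i = (\<nu>, \<alpha>)" by (cases i)
  have \<alpha>: "\<alpha> \<noteq> {#}" and size: "size \<alpha> \<le> k" using i by (auto simp: aut_index_def i_eq)
  have "msubst (elem_subst \<nu> \<alpha> t) (mvar \<mu>) =
      (if \<mu> = \<nu> then mvar \<nu> + mconst t * mprod mvar \<alpha> else mvar \<mu>)" for \<mu>
    unfolding msubst_mvar[OF elem_subst_mord[OF \<alpha>]] by (simp add: elem_subst_def)
  then have "aut_coords k (msubst (elem_subst \<nu> \<alpha> t)) = (\<lambda>j. aut_coords k id j + (if j = i then t else 0))"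
    using size
    by (auto simp: aut_coords_def fun_eq_iff i_eq mcoeff_mprod_mvar)
  with elem_subst_in_grp_R[OF \<alpha> t] show ?thesis by (rule that)
qed

section \<open>Tangent spaces of the groups\<close>

text \<open>The hypotheses of \<open>tangent_space_eqI\<close> in a form that is stable under
  products, so that each group is assembled from its matrix and automorphism factors.\<close>

definition coordinate_lines ::
  "('i \<Rightarrow> 'k::field alg_closure) set \<Rightarrow> ('i \<Rightarrow> 'k) \<Rightarrow> 'i set \<Rightarrow> bool" where
  "coordinate_lines S p I \<longleftrightarrow> finite I \<and> (\<lambda>i. to_ac (p i)) \<in> S \<and>
     (\<forall>x\<in>S. \<forall>i. i \<notin> I \<longrightarrow> x i = 0) \<and>
     (\<forall>i\<in>I. \<forall>t. t \<noteq> - 1 \<longrightarrow> (\<lambda>j. to_ac (p j) + (if j = i then t else 0)) \<in> S)"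

lemma tangent_space_coordinate_lines:
  "coordinate_lines S p I \<Longrightarrow> tangent_space S p = {v. \<forall>i. i \<notin> I \<longrightarrow> v i = 0}"
  unfolding coordinate_lines_def by (intro tangent_space_eqI) auto

text \<open>A coordinate line of a product moves in one factor only, while the other factor stays at
  its base point.\<close>

lemma coordinate_lines_sum:
  assumes S: "coordinate_lines S p I" and S': "coordinate_lines S' p' I'"
  shows "coordinate_lines {case_sum x x' |x x'. x \<in> S \<and> x' \<in> S'} (case_sum p p') (I <+> I')"
  unfolding coordinate_lines_def
proof (intro conjI ballI allI impI)
  show "finite (I <+> I')" using S S' by (simp add: coordinate_lines_def)
  have p: "(\<lambda>i. to_ac (case_sum p p' i)) = case_sum (\<lambda>i. to_ac (p i)) (\<lambda>i. to_ac (p' i))"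
    by (auto split: sum.split)
  show "(\<lambda>i. to_ac (case_sum p p' i)) \<in> {case_sum x x' |x x'. x \<in> S \<and> x' \<in> S'}"
    using S S' unfolding p coordinate_lines_def by blast
  show "y i = 0" if "y \<in> {case_sum x x' |x x'. x \<in> S \<and> x' \<in> S'}" "i \<notin> I <+> I'" for y i
    using that S S' by (cases i) (auto simp: coordinate_lines_def)
  fix i and t :: "'b alg_closure" assume i: "i \<in> I <+> I'" and t: "t \<noteq> - 1"
  let ?q = "\<lambda>j. to_ac (case_sum p p' j) + (if j = i then t else 0)"
  show "?q \<in> {case_sum x x' |x x'. x \<in> S \<and> x' \<in> S'}"
  proof (cases i)
    case (Inl a)
    then have "?q = case_sum (\<lambda>j. to_ac (p j) + (if j = a then t else 0)) (\<lambda>j. to_ac (p' j))"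
      by (auto split: sum.split)
    moreover have "a \<in> I" using i Inl by auto
    ultimately show ?thesis using S S' t unfolding coordinate_lines_def by blast
  next
    case (Inr a)
    then have "?q = case_sum (\<lambda>j. to_ac (p j)) (\<lambda>j. to_ac (p' j) + (if j = a then t else 0))"
      by (auto split: sum.split)
    moreover have "a \<in> I'" using i Inr by auto
    ultimately show ?thesis using S S' t unfolding coordinate_lines_def by blast
  qed
qed

lemma coordinate_lines_mat:
  "coordinate_lines (mat_coords k ` {U :: ('v::finite, 'k::field alg_closure) mfps ^ 'n ^ 'n. invertible U})
     (mat_coords k (mat 1)) (mat_index k)"
  unfolding coordinate_lines_def to_ac_mat_coords_1
proof (intro conjI ballI allI impI finite_mat_index)
  have "invertible (mat 1 :: ('v, 'k alg_closure) mfps ^ 'n ^ 'n)"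
    by (auto simp: invertible_def)
  then show "mat_coords k (mat 1) \<in> mat_coords k ` {U :: ('v, 'k alg_closure) mfps ^ 'n ^ 'n. invertible U}"
    by blast
  fix i :: "'n \<times> 'n \<times> 'v multiset" and t :: "'k alg_closure"
  assume "i \<in> mat_index k" "t \<noteq> - 1"
  then obtain U :: "('v, 'k alg_closure) mfps ^ 'n ^ 'n" where "invertible U"
    "mat_coords k U = (\<lambda>j. mat_coords k (mat 1) j + (if j = i then t else 0))"
    using elementary_matrix by blast
  then show "(\<lambda>j. mat_coords k (mat 1) j + (if j = i then t else 0))
      \<in> mat_coords k ` {U :: ('v, 'k alg_closure) mfps ^ 'n ^ 'n. invertible U}"
    by (metis image_eqI mem_Collect_eq)
qed (auto simp: mat_coords_outside)

lemma coordinate_lines_aut: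
  "coordinate_lines (aut_coords k ` (grp_R :: ('v::finite, 'k::field alg_closure) endo set))
     (aut_coords k id) (aut_index k)"
  unfolding coordinate_lines_def to_ac_aut_coords_id
proof (intro conjI ballI allI impI finite_aut_index)
  show "aut_coords k id \<in> aut_coords k ` (grp_R :: ('v, 'k alg_closure) endo set)"
    using id_in_grp_R by blast
  fix i :: "'v \<times> 'v multiset" and t :: "'k alg_closure"
  assume "i \<in> aut_index k" "t \<noteq> - 1"
  then obtain \<phi> :: "('v, 'k alg_closure) endo" where "\<phi> \<in> grp_R"
    "aut_coords k \<phi> = (\<lambda>j. aut_coords k id j + (if j = i then t else 0))"
    using elementary_automorphism by blast
  then show "(\<lambda>j. aut_coords k id j + (if j = i then t else 0))
      \<in> aut_coords k ` (grp_R :: ('v, 'k alg_closure) endo set)"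
    by (metis image_eqI)
qed (auto simp: aut_coords_outside)

lemma coordinate_lines_lr:
  "coordinate_lines (coords_lr k ` (grp_lr :: ((('v::finite, 'k::field alg_closure) mfps ^ 'm ^ 'm) \<times>
       (('v, 'k alg_closure) mfps ^ 'n ^ 'n) \<times> ('v, 'k alg_closure) endo) set))
     (coords_lr k (mat 1, mat 1, id)) (mat_index k <+> mat_index k <+> aut_index k)"
proof -
  have "coords_lr k ` (grp_lr :: ((('v, 'k alg_closure) mfps ^ 'm ^ 'm) \<times>
       (('v, 'k alg_closure) mfps ^ 'n ^ 'n) \<times> ('v, 'k alg_closure) endo) set) =
    {case_sum x x' |x x'. x \<in> mat_coords k ` {U. invertible U} \<and>
       x' \<in> {case_sum y y' |y y'. y \<in> mat_coords k ` {V. invertible V} \<and> y' \<in> aut_coords k ` grp_R}}"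
    by (force simp: coords_lr_def grp_lr_def)
  then show ?thesis
    using coordinate_lines_sum[OF coordinate_lines_mat coordinate_lines_sum[OF
        coordinate_lines_mat coordinate_lines_aut], of k k k]
    by (simp add: coords_lr_def)
qed

lemma coordinate_lines_l:
  "coordinate_lines (coords_l k ` (grp_l :: ((('v::finite, 'k::field alg_closure) mfps ^ 'm ^ 'm) \<times>
       ('v, 'k alg_closure) endo) set)) (coords_l k (mat 1, id)) (mat_index k <+> aut_index k)"
proof -
  have "coords_l k ` (grp_l :: ((('v, 'k alg_closure) mfps ^ 'm ^ 'm) \<times> ('v, 'k alg_closure) endo) set) =
    {case_sum x x' |x x'. x \<in> mat_coords k ` {U. invertible U} \<and> x' \<in> aut_coords k ` grp_R}"
    by (force simp: coords_l_def grp_l_def)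
  then show ?thesis
    using coordinate_lines_sum[OF coordinate_lines_mat coordinate_lines_aut, of k k]
    by (simp add: coords_l_def)
qed

lemma coords_r_eq: "coords_r = coords_l" and grp_r_eq: "grp_r = grp_l"
  by (auto simp: coords_r_def coords_l_def grp_r_def grp_l_def fun_eq_iff)

section \<open>Tangent images\<close>

lemma matrix_unit_mult: "(matrix_unit p q ** A) $ i $ j = (if i = p then A $ q $ j else 0)"
  by (simp add: matrix_unit_def matrix_matrix_mult_def if_if_eq_conj[symmetric] if_distrib[of "\<lambda>x. x * _"]
      cong: if_cong)

lemma mult_matrix_unit: "(A ** matrix_unit h l) $ i $ j = (if j = l then A $ i $ h else 0)"
  by (simp add: matrix_unit_def matrix_matrix_mult_def if_distrib[of "\<lambda>x. _ * x"] conj_commute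
      if_if_eq_conj[symmetric] cong: if_cong)

text \<open>The map U \<mapsto> U A is R-linear and the matrix units span all matrices U.\<close>

lemma left_module_eq:
  fixes A :: "('v, 'k::field) mfps ^ 'n ^ 'm"
  shows "left_module A = range (\<lambda>U. U ** A)" (is "_ = ?R")
proof
  have "matrix_module.subspace ?R"
    unfolding matrix_module.subspace_def
  proof (intro conjI ballI allI)
    show "0 \<in> ?R" by (rule range_eqI[of _ _ 0]) simp
    fix B assume "B \<in> ?R"
    then obtain U where B: "B = U ** A" by auto
    show "mscale c B \<in> ?R" for c
      by (rule range_eqI[of _ _ "mscale c U"])
        (simp add: B mscale_def matrix_matrix_mult_def vec_eq_iff sum_distrib_left mult.assoc)
    fix C assume "C \<in> ?R"
    then obtain V where "C = V ** A" by auto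
    then show "B + C \<in> ?R"
      by (intro range_eqI[of _ _ "U + V"]) (simp add: B matrix_add_rdistrib)
  qed
  then show "left_module A \<subseteq> ?R"
    unfolding left_module_def by (intro matrix_module.span_minimal) auto
  show "?R \<subseteq> left_module A"
  proof (intro image_subsetI)
    fix U
    have "U ** A = (\<Sum>q\<in>UNIV. \<Sum>p\<in>UNIV. mscale (U $ p $ q) (matrix_unit p q ** A))"
      by (simp add: vec_eq_iff mscale_def matrix_unit_mult if_distrib[of "\<lambda>x. _ * x"] cong: if_cong)
         (simp add: matrix_matrix_mult_def)
    also have "\<dots> \<in> left_module A"
      unfolding left_module_def
      by (intro matrix_module.span_sum matrix_module.span_scale matrix_module.span_base) blast
    finally show "U ** A \<in> left_module A" .
  qed
qed

lemma right_module_eq: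
  fixes A :: "('v, 'k::field) mfps ^ 'n ^ 'm"
  shows "right_module A = range (\<lambda>V. A ** V)" (is "_ = ?R")
proof
  have "matrix_module.subspace ?R"
    unfolding matrix_module.subspace_def
  proof (intro conjI ballI allI)
    show "0 \<in> ?R" by (rule range_eqI[of _ _ 0]) simp
    fix B assume "B \<in> ?R"
    then obtain U where B: "B = A ** U" by auto
    show "mscale c B \<in> ?R" for c
      by (rule range_eqI[of _ _ "mscale c U"])
        (simp add: B mscale_def matrix_matrix_mult_def vec_eq_iff sum_distrib_left mult.left_commute)
    fix C assume "C \<in> ?R"
    then obtain V where "C = A ** V" by auto
    then show "B + C \<in> ?R"
      by (intro range_eqI[of _ _ "U + V"]) (simp add: B matrix_add_ldistrib)
  qed
  then show "right_module A \<subseteq> ?R"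
    unfolding right_module_def by (intro matrix_module.span_minimal) auto
  show "?R \<subseteq> right_module A"
  proof (intro image_subsetI)
    fix V
    have "A ** V = (\<Sum>h\<in>UNIV. \<Sum>l\<in>UNIV. mscale (V $ h $ l) (A ** matrix_unit h l))"
      by (simp add: vec_eq_iff mscale_def mult_matrix_unit if_distrib[of "\<lambda>x. _ * x"] cong: if_cong)
         (simp add: matrix_matrix_mult_def mult.commute)
    also have "\<dots> \<in> right_module A"
      unfolding right_module_def
      by (intro matrix_module.span_sum matrix_module.span_scale matrix_module.span_base) blast
    finally show "A ** V \<in> right_module A" .
  qed
qed

text \<open>A factor from \<mm> is absorbed into the coefficients of a combination of the
  derivatives. Conversely, each summand w_\<nu> \<partial>A/\<partial>x_\<nu> is a generator of the
  product.\<close>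

lemma ideal_smult_deriv_module_eq:
  fixes A :: "('v::finite, 'k::field) mfps ^ 'n ^ 'm"
  shows "ideal_smult max_ideal (deriv_module A) =
    {tangent_vec A 0 0 w |w. \<forall>\<nu>. w \<nu> \<in> mord 1}" (is "_ = ?D")
proof
  have vec: "tangent_vec A 0 0 w = (\<Sum>\<nu>\<in>UNIV. mscale (w \<nu>) (map_matrix (mderiv \<nu>) A))" for w
    by (simp add: tangent_vec_def)
  have scale: "mscale c (tangent_vec A 0 0 w) = tangent_vec A 0 0 (\<lambda>\<nu>. c * w \<nu>)" for c w
    by (simp add: vec matrix_module.scale_sum_right)
  have add: "tangent_vec A 0 0 w + tangent_vec A 0 0 w' = tangent_vec A 0 0 (\<lambda>\<nu>. w \<nu> + w' \<nu>)" for w w'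
    by (simp add: vec matrix_module.scale_left_distrib sum.distrib)
  have zero: "tangent_vec A 0 0 (\<lambda>_. 0) = 0"
    by (simp add: vec)
  have sub: "matrix_module.subspace ?D"
    unfolding matrix_module.subspace_def
  proof (intro conjI ballI allI)
    show "0 \<in> ?D" by (intro CollectI exI[of _ "\<lambda>_. 0"]) (simp add: zero)
    fix B assume "B \<in> ?D"
    then obtain w where w: "\<And>\<nu>. w \<nu> \<in> mord 1" and B: "B = tangent_vec A 0 0 w" by auto
    show "mscale c B \<in> ?D" for c
      unfolding B scale using mord_mult_left[OF w] by blast
    fix C assume "C \<in> ?D"
    then obtain w' where w': "\<And>\<nu>. w' \<nu> \<in> mord 1" and C: "C = tangent_vec A 0 0 w'" by auto
    show "B + C \<in> ?D" unfolding B C add using mord_add[OF w w'] by blast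
  qed
  have deriv: "deriv_module A \<subseteq> range (tangent_vec A 0 0)"
    unfolding deriv_module_def
  proof (rule matrix_module.span_minimal)
    show "matrix_module.subspace (range (tangent_vec A 0 0))"
      unfolding matrix_module.subspace_def using zero[symmetric] by (auto simp: add scale)
    have "map_matrix (mderiv \<nu>) A = tangent_vec A 0 0 (\<lambda>\<mu>. if \<mu> = \<nu> then 1 else 0)" for \<nu>
      by (simp add: vec if_distrib[of "\<lambda>x. mscale x _"] cong: if_cong)
    then show "{map_matrix (mderiv \<nu>) A |\<nu>. True} \<subseteq> range (tangent_vec A 0 0)" by auto
  qed
  show "ideal_smult max_ideal (deriv_module A) \<subseteq> ?D"
    unfolding ideal_smult_def
  proof (rule matrix_module.span_minimal[OF _ sub], rule subsetI)
    fix B assume "B \<in> {mscale a B |a B. a \<in> max_ideal \<and> B \<in> deriv_module A}"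
    then obtain a w where a: "a \<in> mord 1" and B: "B = mscale a (tangent_vec A 0 0 w)"
      using deriv by (auto simp: max_ideal_eq_mord)
    show "B \<in> ?D" unfolding B scale using mord_mult_right[OF a] by blast
  qed
  show "?D \<subseteq> ideal_smult max_ideal (deriv_module A)"
  proof
    fix B assume "B \<in> ?D"
    then obtain w where w: "\<And>\<nu>. w \<nu> \<in> mord 1" and B: "B = tangent_vec A 0 0 w" by auto
    have "mscale (w \<nu>) (map_matrix (mderiv \<nu>) A) \<in> ideal_smult max_ideal (deriv_module A)" for \<nu>
      unfolding ideal_smult_def
    proof (rule matrix_module.span_base)
      have "map_matrix (mderiv \<nu>) A \<in> deriv_module A"
        unfolding deriv_module_def by (rule matrix_module.span_base) blast
      then show "mscale (w \<nu>) (map_matrix (mderiv \<nu>) A)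
          \<in> {mscale a B |a B. a \<in> max_ideal \<and> B \<in> deriv_module A}"
        using w[of \<nu>] by (auto simp: max_ideal_eq_mord)
    qed
    then show "B \<in> ideal_smult max_ideal (deriv_module A)"
      unfolding B vec ideal_smult_def by (rule matrix_module.span_sum)
  qed
qed

section \<open>Specialising the universal group element\<close>

lemma tangent_vec_split: "tangent_vec A U V w = U ** A + A ** V + tangent_vec A 0 0 w"
  by (simp add: tangent_vec_def)

lemma map_matrix_mat_1: "ring_morphism h \<Longrightarrow> map_matrix (map_mfps h) (mat 1) = mat 1"
  using ring_morphism.hom_zero[OF ring_morphism.map_mfps_morphism]
    ring_morphism.hom_one[OF ring_morphism.map_mfps_morphism]
  by (auto simp: map_matrix_def mat_def vec_eq_iff)

lemma dual_val_PVar: "dual_val p v (PVar i) = [:p i, v i:]"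
  by (simp add: dual_val_def ring_morphism.poly_val_PVar[OF const_poly_morphism])

lemma dual_val_mat_1:
  "map_matrix (\<lambda>f. order0 (map_mfps (dual_val e v) f)) (mat 1) = mat 1"
  "map_matrix (\<lambda>f. order1 (map_mfps (dual_val e v) f)) (mat 1) = 0"
proof -
  have "dual_val e v 1 = 1" "dual_val e v 0 = 0"
    using ring_morphism.hom_one[OF dual_val_morphism] ring_morphism.hom_zero[OF dual_val_morphism]
    by blast+
  then show "map_matrix (\<lambda>f. order0 (map_mfps (dual_val e v) f)) (mat 1) = mat 1"
    "map_matrix (\<lambda>f. order1 (map_mfps (dual_val e v) f)) (mat 1) = 0"
    by (auto simp: map_matrix_def mat_def vec_eq_iff intro!: mfps_eqI)
qed

lemma dual_val_mat_of_coords: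
  "map_matrix (\<lambda>f. order0 (map_mfps (dual_val e v) f)) (mat_of_coords k (\<lambda>i. PVar (\<iota> i))) =
     mat_of_coords k (\<lambda>i. e (\<iota> i))"
  "map_matrix (\<lambda>f. order1 (map_mfps (dual_val e v) f)) (mat_of_coords k (\<lambda>i. PVar (\<iota> i))) =
     mat_of_coords k (\<lambda>i. v (\<iota> i))"
  by (simp_all add: map_mfps_map_mfps map_mat_of_coords ring_morphism.hom_zero[OF dual_val_morphism]
      dual_val_PVar)

lemma dual_val_series_of_coords:
  "map_mfps (dual_val e v) (series_of_coords k (\<lambda>i. PVar (\<iota> i)) \<nu>) =
     series_of_coords k (\<lambda>i. [:e (\<iota> i), v (\<iota> i):]) \<nu>"
  "order0 (series_of_coords k (\<lambda>i. [:a i, b i:]) \<nu>) = series_of_coords k a \<nu>"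
  "order1 (series_of_coords k (\<lambda>i. [:a i, b i:]) \<nu>) = series_of_coords k b \<nu>"
  by (simp_all add: map_series_of_coords ring_morphism.hom_zero[OF dual_val_morphism] dual_val_PVar)

lemma spec_coords:
  "map_matrix (map_mfps (poly_val to_ac x)) (mat_of_coords k (\<lambda>i. PVar (\<iota> i))) =
     mat_of_coords k (\<lambda>i. x (\<iota> i))"
  "map_mfps (poly_val to_ac x) (series_of_coords k (\<lambda>i. PVar (\<kappa> i)) \<nu>) =
     series_of_coords k (\<lambda>i. x (\<kappa> i)) \<nu>"
  by (simp_all add: map_mat_of_coords map_series_of_coords ring_morphism.poly_val_PVar[OF to_ac_morphism]
      ring_morphism.hom_zero[OF ring_morphism.poly_val_morphism[OF to_ac_morphism]])

lemma series_of_coords_aut_coords_id: "1 \<le> k \<Longrightarrow> series_of_coords k (aut_coords k id) \<nu> = mvar \<nu>"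
  by (simp add: aut_coords_eq series_of_coords_mvar)

lemma series_of_coords_aut_coords: "series_of_coords k (aut_coords k \<phi>) \<nu> - \<phi> (mvar \<nu>) \<in> mord (Suc k)"
  unfolding aut_coords_eq by (rule series_of_coords_series_coords)

text \<open>The constant coefficients have indices outside \<open>aut_index k\<close>, where both
  the identity and the tangent vector vanish. This supplies the order condition that the universal
  series itself lacks.\<close>

lemma dual_series_mord_1:
  fixes v :: "'i \<Rightarrow> 'k::field"
  assumes "\<And>i. i \<notin> aut_index k \<Longrightarrow> v (\<iota> i) = 0"
  shows "series_of_coords k (\<lambda>i. [:aut_coords k id i, v (\<iota> i):]) \<nu> \<in> mord 1"
  using assms by (intro series_of_coords_mord_1) (simp add: aut_coords_outside[OF id_in_grp_R])

lemmas universal_simps = dual_val_mat_of_coords dual_val_series_of_coords dual_val_mat_1 spec_coords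
  map_matrix_mat_1[OF ring_morphism.poly_val_morphism[OF to_ac_morphism]]

section \<open>The tangent images of the four groups\<close>

lemma coordinate_lines_R:
  "coordinate_lines (coords_R k ` (grp_R :: ('v::finite, 'k::field alg_closure) endo set))
     (coords_R k id) (aut_index k)"
  using coordinate_lines_aut[of k] by (simp add: coords_R_def[abs_def])

lemma coordinate_lines_r:
  "coordinate_lines (coords_r k ` (grp_r :: ((('v::finite, 'k::field alg_closure) mfps ^ 'n ^ 'n) \<times>
       ('v, 'k alg_closure) endo) set)) (coords_r k (mat 1, id)) (mat_index k <+> aut_index k)"
  unfolding coords_r_eq grp_r_eq by (rule coordinate_lines_l)

lemma tangent_image_lr:
  fixes A :: "('v::finite, 'k::field) mfps ^ 'n ^ 'm"
  assumes k: "1 \<le> k"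
  shows "orbit_tangent_map_welldef grp_lr (coords_lr k) (coords_lr k (mat 1, mat 1, id)) act_lr k A \<and>
    tangent_image grp_lr (coords_lr k) (coords_lr k (mat 1, mat 1, id)) act_lr k A =
      jet k ` (left_module A + right_module A + ideal_smult max_ideal (deriv_module A) + jet_kernel k)"
proof -
  let ?T = "{v. \<forall>i. i \<notin> mat_index k <+> mat_index k <+> aut_index k \<longrightarrow> v i = 0}"
  let ?\<Delta> = "\<lambda>v. tangent_vec A (mat_of_coords k (\<lambda>i. v (Inl i))) (mat_of_coords k (\<lambda>i. v (Inr (Inl i))))
    (series_of_coords k (\<lambda>i. v (Inr (Inr i))))"
  have "orbit_tangent_map_welldef grp_lr (coords_lr k) (coords_lr k (mat 1, mat 1, id)) act_lr k A \<and>
    tangent_image grp_lr (coords_lr k) (coords_lr k (mat 1, mat 1, id)) act_lr k A = jet k ` ?\<Delta> ` ?T"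
  \<comment> \<open>Every coordinate gets its own variable. The first goal compares the
    specialisation at \<open>crd g\<close> with g up to degree k; the others evaluate at e +
    \<epsilon> v.\<close>
  proof (rule tangent_image_generic[where G = grp_lr and crd = "coords_lr k"
        and act = act_lr and k = k
        and e = "coords_lr k (mat 1, mat 1, id)" and A = A and U = "mat_of_coords k (\<lambda>i. PVar (Inl i))"
        and V = "mat_of_coords k (\<lambda>i. PVar (Inr (Inl i)))"
        and Y = "series_of_coords k (\<lambda>i. PVar (Inr (Inr i)))",
        unfolded universal_simps tangent_space_coordinate_lines[OF coordinate_lines_lr]], goal_cases)
    case (1 g)
    then obtain U V \<phi> where "g = (U, V, \<phi>)" "\<phi> \<in> grp_R"
      by (auto simp: grp_lr_def)
    then show ?case
      by (intro exI[of _ "U"] exI[of _ "V"] exI[of _ \<phi>])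
         (auto simp: coords_lr_def act_lr_def mat_coords_mat_of_coords series_of_coords_aut_coords)
  qed (use k in \<open>auto simp: coords_lr_def mat_of_coords_1 series_of_coords_aut_coords_id
      simp del: One_nat_def intro!: dual_series_mord_1\<close>)
  moreover have "jet k ` ?\<Delta> ` ?T =
    jet k ` (left_module A + right_module A + ideal_smult max_ideal (deriv_module A) + jet_kernel k)"
  proof (rule jet_image_eq)
    fix v :: "'m \<times> 'm \<times> 'v multiset + 'n \<times> 'n \<times> 'v multiset + 'v \<times> 'v multiset \<Rightarrow> 'k"
    assume v: "v \<in> ?T"
    have "(series_of_coords k (\<lambda>i. v (Inr (Inr i)))) \<nu> \<in> mord 1" for \<nu>
      using v by (intro series_of_coords_mord_1) auto
    then have "(mat_of_coords k (\<lambda>i. v (Inl i))) ** A +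
        A ** (mat_of_coords k (\<lambda>i. v (Inr (Inl i)))) +
        tangent_vec A 0 0 (series_of_coords k (\<lambda>i. v (Inr (Inr i))))
        \<in> left_module A + right_module A + ideal_smult max_ideal (deriv_module A)"
      unfolding left_module_eq right_module_eq ideal_smult_deriv_module_eq
      by (intro set_plus_intro) auto
    then show "?\<Delta> v \<in> left_module A + right_module A + ideal_smult max_ideal (deriv_module A)"
      by (subst tangent_vec_split) simp
  next
    fix B assume "B \<in> left_module A + right_module A + ideal_smult max_ideal (deriv_module A)"
    then obtain U V w where w: "\<And>\<nu>. w \<nu> \<in> mord 1" and B: "B = tangent_vec A U V w"
      unfolding left_module_eq right_module_eq ideal_smult_deriv_module_eq
      by (auto elim!: set_plus_elim simp: tangent_vec_def)
    \<comment> \<open>The tangent vector consists of the truncations of U, V and w, which alter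
      \<open>tangent_vec\<close> only in \<mm>^(k+1).\<close>
    let ?v = "case_sum (mat_coords k U) (case_sum (mat_coords k V) (series_coords k w))"
    have "?v \<in> ?T"
      using w by (auto intro: mat_coords_support series_coords_support simp del: One_nat_def
          split: sum.splits)
    moreover have "mat_coords k (?\<Delta> ?v) = mat_coords k B"
      unfolding B by (intro mat_coords_tangent_vec_cong)
        (simp_all add: mat_coords_mat_of_coords series_of_coords_series_coords)
    ultimately show "\<exists>v\<in>?T. mat_coords k (?\<Delta> v) = mat_coords k B" by blast
  qed
  ultimately show ?thesis by simp
qed

lemma tangent_image_R:
  fixes A :: "('v::finite, 'k::field) mfps ^ 'n ^ 'm"
  assumes k: "1 \<le> k"
  shows "orbit_tangent_map_welldef grp_R (coords_R k) (coords_R k id) act_R k A \<and>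
    tangent_image grp_R (coords_R k) (coords_R k id) act_R k A =
      jet k ` (ideal_smult max_ideal (deriv_module A) + jet_kernel k)"
proof -
  let ?T = "{v. \<forall>i. i \<notin> aut_index k \<longrightarrow> v i = 0}"
  let ?\<Delta> = "\<lambda>v. tangent_vec A 0 0
    (series_of_coords k (\<lambda>i. v (i)))"
  have "orbit_tangent_map_welldef grp_R (coords_R k) (coords_R k id) act_R k A \<and>
    tangent_image grp_R (coords_R k) (coords_R k id) act_R k A = jet k ` ?\<Delta> ` ?T"
  \<comment> \<open>Missing matrix factors are represented by constant identity matrices, whose
    \<epsilon>-part is 0.\<close>
  proof (rule tangent_image_generic[where G = grp_R and crd = "coords_R k"
        and act = act_R and k = k
        and e = "coords_R k id" and A = A and U = "mat 1"
        and V = "mat 1" and Y = "series_of_coords k (\<lambda>i. PVar (i))",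
        unfolded universal_simps tangent_space_coordinate_lines[OF coordinate_lines_R]], goal_cases)
    case (1 g)
    then obtain  \<phi> where "g = \<phi>" "\<phi> \<in> grp_R"
      by (auto simp: grp_R_def)
    then show ?case
      by (intro exI[of _ "mat 1"] exI[of _ "mat 1"] exI[of _ \<phi>])
         (auto simp: coords_R_def act_R_def mat_coords_mat_of_coords series_of_coords_aut_coords)
  qed (use k in \<open>auto simp: coords_R_def mat_of_coords_1 series_of_coords_aut_coords_id
      simp del: One_nat_def intro!: dual_series_mord_1\<close>)
  moreover have "jet k ` ?\<Delta> ` ?T =
    jet k ` (ideal_smult max_ideal (deriv_module A) + jet_kernel k)"
  proof (rule jet_image_eq)
    fix v :: "'v \<times> 'v multiset \<Rightarrow> 'k"
    assume v: "v \<in> ?T"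
    have "(series_of_coords k (\<lambda>i. v (i))) \<nu> \<in> mord 1" for \<nu>
      using v by (intro series_of_coords_mord_1) auto
    then show "?\<Delta> v \<in> ideal_smult max_ideal (deriv_module A)"
      unfolding ideal_smult_deriv_module_eq by auto
  next
    fix B assume "B \<in> ideal_smult max_ideal (deriv_module A)"
    then obtain w where w: "\<And>\<nu>. w \<nu> \<in> mord 1" and B: "B = tangent_vec A 0 0 w"
      unfolding  ideal_smult_deriv_module_eq
      by (auto elim!: set_plus_elim simp: tangent_vec_def)
    let ?v = "series_coords k w"
    have "?v \<in> ?T"
      using w by (auto intro: mat_coords_support series_coords_support simp del: One_nat_def
          split: sum.splits)
    moreover have "mat_coords k (?\<Delta> ?v) = mat_coords k B"
      unfolding B by (intro mat_coords_tangent_vec_cong)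
        (simp_all add: mat_coords_mat_of_coords series_of_coords_series_coords)
    ultimately show "\<exists>v\<in>?T. mat_coords k (?\<Delta> v) = mat_coords k B" by blast
  qed
  ultimately show ?thesis by simp
qed

lemma tangent_image_l:
  fixes A :: "('v::finite, 'k::field) mfps ^ 'n ^ 'm"
  assumes k: "1 \<le> k"
  shows "orbit_tangent_map_welldef grp_l (coords_l k) (coords_l k (mat 1, id)) act_l k A \<and>
    tangent_image grp_l (coords_l k) (coords_l k (mat 1, id)) act_l k A =
      jet k ` (left_module A + ideal_smult max_ideal (deriv_module A) + jet_kernel k)"
proof -
  let ?T = "{v. \<forall>i. i \<notin> mat_index k <+> aut_index k \<longrightarrow> v i = 0}"
  let ?\<Delta> = "\<lambda>v. tangent_vec A (mat_of_coords k (\<lambda>i. v (Inl i))) 0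
    (series_of_coords k (\<lambda>i. v (Inr i)))"
  have "orbit_tangent_map_welldef grp_l (coords_l k) (coords_l k (mat 1, id)) act_l k A \<and>
    tangent_image grp_l (coords_l k) (coords_l k (mat 1, id)) act_l k A = jet k ` ?\<Delta> ` ?T"
  proof (rule tangent_image_generic[where G = grp_l and crd = "coords_l k"
        and act = act_l and k = k
        and e = "coords_l k (mat 1, id)" and A = A and U = "mat_of_coords k (\<lambda>i. PVar (Inl i))"
        and V = "mat 1" and Y = "series_of_coords k (\<lambda>i. PVar (Inr i))",
        unfolded universal_simps tangent_space_coordinate_lines[OF coordinate_lines_l]], goal_cases)
    case (1 g)
    then obtain U \<phi> where "g = (U, \<phi>)" "\<phi> \<in> grp_R"
      by (auto simp: grp_l_def)
    then show ?case
      by (intro exI[of _ "U"] exI[of _ "mat 1"] exI[of _ \<phi>])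
         (auto simp: coords_l_def act_l_def mat_coords_mat_of_coords series_of_coords_aut_coords)
  qed (use k in \<open>auto simp: coords_l_def mat_of_coords_1 series_of_coords_aut_coords_id
      simp del: One_nat_def intro!: dual_series_mord_1\<close>)
  moreover have "jet k ` ?\<Delta> ` ?T =
    jet k ` (left_module A + ideal_smult max_ideal (deriv_module A) + jet_kernel k)"
  proof (rule jet_image_eq)
    fix v :: "'m \<times> 'm \<times> 'v multiset + 'v \<times> 'v multiset \<Rightarrow> 'k"
    assume v: "v \<in> ?T"
    have "(series_of_coords k (\<lambda>i. v (Inr i))) \<nu> \<in> mord 1" for \<nu>
      using v by (intro series_of_coords_mord_1) auto
    then have "(mat_of_coords k (\<lambda>i. v (Inl i))) ** A +
        tangent_vec A 0 0 (series_of_coords k (\<lambda>i. v (Inr i)))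
        \<in> left_module A + ideal_smult max_ideal (deriv_module A)"
      unfolding left_module_eq ideal_smult_deriv_module_eq
      by (intro set_plus_intro) auto
    then show "?\<Delta> v \<in> left_module A + ideal_smult max_ideal (deriv_module A)"
      by (subst tangent_vec_split) simp
  next
    fix B assume "B \<in> left_module A + ideal_smult max_ideal (deriv_module A)"
    then obtain U w where w: "\<And>\<nu>. w \<nu> \<in> mord 1" and B: "B = tangent_vec A U 0 w"
      unfolding left_module_eq ideal_smult_deriv_module_eq
      by (auto elim!: set_plus_elim simp: tangent_vec_def)
    let ?v = "case_sum (mat_coords k U) (series_coords k w)"
    have "?v \<in> ?T"
      using w by (auto intro: mat_coords_support series_coords_support simp del: One_nat_def
          split: sum.splits)
    moreover have "mat_coords k (?\<Delta> ?v) = mat_coords k B"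
      unfolding B by (intro mat_coords_tangent_vec_cong)
        (simp_all add: mat_coords_mat_of_coords series_of_coords_series_coords)
    ultimately show "\<exists>v\<in>?T. mat_coords k (?\<Delta> v) = mat_coords k B" by blast
  qed
  ultimately show ?thesis by simp
qed

lemma tangent_image_r:
  fixes A :: "('v::finite, 'k::field) mfps ^ 'n ^ 'm"
  assumes k: "1 \<le> k"
  shows "orbit_tangent_map_welldef grp_r (coords_r k) (coords_r k (mat 1, id)) act_r k A \<and>
    tangent_image grp_r (coords_r k) (coords_r k (mat 1, id)) act_r k A =
      jet k ` (right_module A + ideal_smult max_ideal (deriv_module A) + jet_kernel k)"
proof -
  let ?T = "{v. \<forall>i. i \<notin> mat_index k <+> aut_index k \<longrightarrow> v i = 0}"
  let ?\<Delta> = "\<lambda>v. tangent_vec A 0 (mat_of_coords k (\<lambda>i. v (Inl i)))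
    (series_of_coords k (\<lambda>i. v (Inr i)))"
  have "orbit_tangent_map_welldef grp_r (coords_r k) (coords_r k (mat 1, id)) act_r k A \<and>
    tangent_image grp_r (coords_r k) (coords_r k (mat 1, id)) act_r k A = jet k ` ?\<Delta> ` ?T"
  proof (rule tangent_image_generic[where G = grp_r and crd = "coords_r k"
        and act = act_r and k = k
        and e = "coords_r k (mat 1, id)" and A = A and U = "mat 1"
        and V = "mat_of_coords k (\<lambda>i. PVar (Inl i))" and Y = "series_of_coords k (\<lambda>i. PVar (Inr i))",
        unfolded universal_simps tangent_space_coordinate_lines[OF coordinate_lines_r]], goal_cases)
    case (1 g)
    then obtain V \<phi> where "g = (V, \<phi>)" "\<phi> \<in> grp_R"
      by (auto simp: grp_r_def)
    then show ?case
      by (intro exI[of _ "mat 1"] exI[of _ "V"] exI[of _ \<phi>])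
         (auto simp: coords_r_def act_r_def mat_coords_mat_of_coords series_of_coords_aut_coords)
  qed (use k in \<open>auto simp: coords_r_def mat_of_coords_1 series_of_coords_aut_coords_id
      simp del: One_nat_def intro!: dual_series_mord_1\<close>)
  moreover have "jet k ` ?\<Delta> ` ?T =
    jet k ` (right_module A + ideal_smult max_ideal (deriv_module A) + jet_kernel k)"
  proof (rule jet_image_eq)
    fix v :: "'n \<times> 'n \<times> 'v multiset + 'v \<times> 'v multiset \<Rightarrow> 'k"
    assume v: "v \<in> ?T"
    have "(series_of_coords k (\<lambda>i. v (Inr i))) \<nu> \<in> mord 1" for \<nu>
      using v by (intro series_of_coords_mord_1) auto
    then have "A ** (mat_of_coords k (\<lambda>i. v (Inl i))) +
        tangent_vec A 0 0 (series_of_coords k (\<lambda>i. v (Inr i)))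
        \<in> right_module A + ideal_smult max_ideal (deriv_module A)"
      unfolding right_module_eq ideal_smult_deriv_module_eq
      by (intro set_plus_intro) auto
    then show "?\<Delta> v \<in> right_module A + ideal_smult max_ideal (deriv_module A)"
      by (subst tangent_vec_split) simp
  next
    fix B assume "B \<in> right_module A + ideal_smult max_ideal (deriv_module A)"
    then obtain V w where w: "\<And>\<nu>. w \<nu> \<in> mord 1" and B: "B = tangent_vec A 0 V w"
      unfolding right_module_eq ideal_smult_deriv_module_eq
      by (auto elim!: set_plus_elim simp: tangent_vec_def)
    let ?v = "case_sum (mat_coords k V) (series_coords k w)"
    have "?v \<in> ?T"
      using w by (auto intro: mat_coords_support series_coords_support simp del: One_nat_def
          split: sum.splits)
    moreover have "mat_coords k (?\<Delta> ?v) = mat_coords k B"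
      unfolding B by (intro mat_coords_tangent_vec_cong)
        (simp_all add: mat_coords_mat_of_coords series_of_coords_series_coords)
    ultimately show "\<exists>v\<in>?T. mat_coords k (?\<Delta> v) = mat_coords k B" by blast
  qed
  ultimately show ?thesis by simp
qed

theorem proposition2p5:
  fixes A :: "('v::finite, 'k::field) mfps ^ 'n ^ 'm" and k :: nat
  assumes "1 \<le> k"
  shows
    "orbit_tangent_map_welldef grp_lr (coords_lr k) (coords_lr k (mat 1, mat 1, id)) act_lr k A \<and>
     tangent_image grp_lr (coords_lr k) (coords_lr k (mat 1, mat 1, id)) act_lr k A =
       jet k ` (left_module A + right_module A + ideal_smult max_ideal (deriv_module A) + jet_kernel k)
     \<and>
     orbit_tangent_map_welldef grp_R (coords_R k) (coords_R k id) act_R k A \<and>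
     tangent_image grp_R (coords_R k) (coords_R k id) act_R k A =
       jet k ` (ideal_smult max_ideal (deriv_module A) + jet_kernel k)
     \<and>
     orbit_tangent_map_welldef grp_l (coords_l k) (coords_l k (mat 1, id)) act_l k A \<and>
     tangent_image grp_l (coords_l k) (coords_l k (mat 1, id)) act_l k A =
       jet k ` (left_module A + ideal_smult max_ideal (deriv_module A) + jet_kernel k)
     \<and>
     orbit_tangent_map_welldef grp_r (coords_r k) (coords_r k (mat 1, id)) act_r k A \<and>
     tangent_image grp_r (coords_r k) (coords_r k (mat 1, id)) act_r k A =
       jet k ` (right_module A + ideal_smult max_ideal (deriv_module A) + jet_kernel k)"
  using tangent_image_lr[OF assms, of A] tangent_image_R[OF assms, of A]
    tangent_image_l[OF assms, of A] tangent_image_r[OF assms, of A]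
    by (elim conjE, intro conjI)

end
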